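(* Let $1\le k\le n$, and let $u:\mathbb{R}^n\to\mathbb{R}$ be a smooth $k$-convex function satisfying, on $\mathbb{R}^n$, $$-\frac{\sigma_{k-1}}{\sigma_k}(D^2u)=\frac{1}{2}\,x\cdot Du-u.$$ Then $u$ is a quadratic polynomial.
   Context: For $1\le k\le n$, $\sigma_k(\lambda)=\sum_{i_1<\cdots<i_k}\lambda_{i_1}\cdots\lambda_{i_k}$ for $\lambda\in\mathbb{R}^n$ is the $k$-th elementary symmetric polynomial, with $\sigma_0=1$, and $\Gamma_k=\{\lambda\in\mathbb{R}^n\mid\sigma_j(\lambda)>0,\ 1\le j\le k\}$. For a real symmetric matrix $A$, $\lambda(A)$ denotes its eigenvalues. A $C^2$ function $u$ on $\mathbb{R}^n$ is called $k$-convex if $\lambda(D^2u)\in\Gamma_k$ everywhere, and $-\frac{\sigma_{k-1}}{\sigma_k}(D^2u)=-\frac{\sigma_{k-1}(\lambda(D^2u))}{\sigma_k(\lambda(D^2u))}$. $Du$ and $D^2u$ are the gradient and Hessian of $u$, $x$ is the position vector, and "$\cdot$" is the Euclidean inner product. "Quadratic polynomial" means a real polynomial of degree at most $2$ (equivalently, $D^2u$ is constant). *)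

theory Defs
  imports
    "HOL-Analysis.Analysis"
    "HOL-Computational_Algebra.Polynomial"
begin

definition partial_deriv :: "'n::finite \<Rightarrow> (real^'n \<Rightarrow> real) \<Rightarrow> real^'n \<Rightarrow> real" where
  "partial_deriv i f x = frechet_derivative f (at x) (axis i 1)"

text \<open>\<open>frechet_derivative\<close> is total, so differentiability is required explicitly
  before the partial derivatives are used.\<close>

primrec C_diff :: "nat \<Rightarrow> (real^'n::finite \<Rightarrow> real) \<Rightarrow> bool" where
  "C_diff 0 f \<longleftrightarrow> continuous_on UNIV f"
| "C_diff (Suc m) f \<longleftrightarrow> (\<forall>x. f differentiable (at x)) \<and> (\<forall>i. C_diff m (partial_deriv i f))"

definition smooth_fun :: "(real^'n::finite \<Rightarrow> real) \<Rightarrow> bool" where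
  "smooth_fun f \<longleftrightarrow> (\<forall>m. C_diff m f)"

definition gradient :: "(real^'n::finite \<Rightarrow> real) \<Rightarrow> real^'n \<Rightarrow> real^'n" where
  "gradient f x = (\<chi> i. partial_deriv i f x)"

definition hessian :: "(real^'n::finite \<Rightarrow> real) \<Rightarrow> real^'n \<Rightarrow> real^'n^'n" where
  "hessian f x = (\<chi> i j. partial_deriv j (partial_deriv i f) x)"

definition elem_sym :: "nat \<Rightarrow> real^'n::finite \<Rightarrow> real" where
  "elem_sym k l = (\<Sum>S | S \<subseteq> (UNIV :: 'n set) \<and> card S = k. \<Prod>i\<in>S. l $ i)"

definition Gamma_cone :: "nat \<Rightarrow> (real^'n::finite) set" where
  "Gamma_cone k = {l. \<forall>j\<in>{1..k}. elem_sym j l > 0}"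

definition charpoly :: "real^'n^'n::finite \<Rightarrow> real poly" where
  "charpoly A = det (mat [:0, 1:] - (\<chi> i j. [:A $ i $ j:]))"

text \<open>The eigenvalues, repeated according to algebraic multiplicity, as a vector. For a symmetric
  matrix such a vector exists by the spectral theorem; it is unique up to the order of its entries,
  on which neither \<^const>\<open>elem_sym\<close> nor \<^const>\<open>Gamma_cone\<close> depends.
  All matrices below are Hessians of functions of class at least 2, hence symmetric.\<close>

definition eigenvals :: "real^'n^'n::finite \<Rightarrow> real^'n" where
  "eigenvals A = (SOME l. image_mset (\<lambda>i. l $ i) (mset_set UNIV) = proots (charpoly A))"

definition k_convex :: "nat \<Rightarrow> (real^'n::finite \<Rightarrow> real) \<Rightarrow> bool" where
  "k_convex k u \<longleftrightarrow> C_diff 2 u \<and> (\<forall>x. eigenvals (hessian u x) \<in> Gamma_cone k)"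

definition quadratic_polynomial :: "(real^'n::finite \<Rightarrow> real) \<Rightarrow> bool" where
  "quadratic_polynomial u \<longleftrightarrow>
     (\<exists>(A :: real^'n^'n) (b :: real^'n) (c :: real). \<forall>x. u x = x \<bullet> (A *v x) + b \<bullet> x + c)"

end

theory Submission
  imports Defs
begin

text \<open>Put \<open>\<phi> = x \<bullet> Du / 2 - u < 0\<close>. Differentiating the equation along the position vector and using
  \<open>x \<bullet> D(D\<^sup>2u) = 2 D\<^sup>2\<phi>\<close> gives \<open>F\<^sup>i\<^sup>j \<phi>\<^sub>i\<^sub>j = x \<bullet> D\<phi> / 2\<close>, with \<open>F = - \<sigma>\<^sub>k\<^sub>-\<^sub>1 / \<sigma>\<^sub>k\<close>; this is elliptic by Newton's
  inequality, and \<open>tr F\<^sup>i\<^sup>j \<le> n \<phi>\<^sup>2\<close>. A maximum point \<open>p\<close> of \<open>\<phi> - \<epsilon> |x|\<^sup>2\<close> has \<open>\<phi>(0) \<le> \<phi>(p) < 0\<close>, so there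
  the trace is bounded and \<open>|p|\<^sup>2 \<le> 2 n \<phi>(0)\<^sup>2\<close> independently of \<open>\<epsilon>\<close>. Hence \<open>\<phi>\<close> attains its maximum and
  is constant by the strong maximum principle. Then \<open>x \<bullet> D(D\<^sup>2u) = 0\<close>, so \<open>D\<^sup>2u\<close> is constant
  along rays.\<close>

subsection \<open>Elementary symmetric polynomials\<close>

text \<open>\<open>eigenvals\<close> picks an ordering separately at each point, and eigenvalues
  need not be differentiable where they collide, so the equation is not differentiated through them.
  It is differentiated through the coefficients of the characteristic polynomial, which are
  polynomials in the Hessian entries; an eigenbasis at the one point under consideration then
  diagonalises the result, and nothing is asked about how this basis varies. The same obstacle
  shapes the strong maximum principle: its ellipticity constant comes from compactness in the space
  of eigenvalue vectors. The radial direction is singled out because there the third derivatives of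
  \<open>u\<close> are expressed by second derivatives of \<open>\<phi>\<close>, so one
  differentiation already closes the equation on \<open>\<phi>\<close>. On the whole space neither a
  positive lower bound for the operator nor an upper bound for its trace is at hand, since
  \<open>\<phi>\<close> might be unbounded below; hence the maximum must first be confined to a
  ball, and only local ellipticity enters afterwards.\<close>

definition esym :: "nat \<Rightarrow> 'a set \<Rightarrow> ('a \<Rightarrow> real) \<Rightarrow> real" where
  "esym k S l = (\<Sum>T | T \<subseteq> S \<and> card T = k. \<Prod>i\<in>T. l i)"

lemma elem_sym_eq_esym: "elem_sym k l = esym k UNIV (($) l)"
  by (simp add: elem_sym_def esym_def)

lemma esym_0 [simp]: "finite S \<Longrightarrow> esym 0 S l = 1"
proof -
  assume "finite S"
  then have "{T. T \<subseteq> S \<and> card T = 0} = {{}}"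
    by (auto simp: card_eq_0_iff dest: finite_subset)
  then show ?thesis by (simp add: esym_def)
qed

lemma esym_eq_0: "finite S \<Longrightarrow> card S < k \<Longrightarrow> esym k S l = 0"
  unfolding esym_def by (intro sum.neutral) (auto dest: card_mono[of S])

lemma esym_Suc_insert:
  assumes "finite S" "i \<notin> S"
  shows "esym (Suc k) (insert i S) l = esym (Suc k) S l + l i * esym k S l"
proof -
  have eq: "{T. T \<subseteq> insert i S \<and> card T = Suc k} =
      {T. T \<subseteq> S \<and> card T = Suc k} \<union> insert i ` {T. T \<subseteq> S \<and> card T = k}" (is "?L = ?A \<union> ?B")
  proof (intro equalityI subsetI)
    fix T assume T: "T \<in> ?L"
    show "T \<in> ?A \<union> ?B"
    proof (cases "i \<in> T")
      case True
      then have "T = insert i (T - {i})" "T - {i} \<subseteq> S" "card (T - {i}) = k"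
        using T by auto
      then show ?thesis by blast
    qed (use T in auto)
  next
    fix T assume "T \<in> ?A \<union> ?B"
    then show "T \<in> ?L"
    proof
      assume "T \<in> ?B"
      then obtain U where "U \<subseteq> S" "card U = k" "T = insert i U" by auto
      moreover have "finite U" "i \<notin> U" using calculation assms finite_subset by auto
      ultimately show ?thesis by auto
    qed auto
  qed
  have "inj_on (insert i) {T. T \<subseteq> S \<and> card T = k}"
    using assms by (auto simp: inj_on_def)
  moreover have "(\<Prod>j\<in>insert i T. l j) = l i * (\<Prod>j\<in>T. l j)" if "T \<subseteq> S" for T
    using that assms finite_subset by (subst prod.insert) auto
  moreover have "?A \<inter> ?B = {}" using assms by auto
  ultimately show ?thesis
    unfolding esym_def eq using assms
    by (subst sum.union_disjoint) (auto simp: sum.reindex sum_distrib_left intro!: sum.cong)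
qed

lemma esym_Suc_remove:
  assumes "finite S" "i \<in> S"
  shows "esym (Suc k) S l = esym (Suc k) (S - {i}) l + l i * esym k (S - {i}) l"
  using esym_Suc_insert[of "S - {i}" i k l] assms by (simp add: insert_absorb)

text \<open>Double counting: a subset \<open>T\<close> of size \<open>k\<close> survives the removal
  of \<open>i\<close> exactly for the \<open>card S - k\<close> indices outside \<open>T\<close>.
  The subtraction is in the reals; for \<open>k > card S\<close> both sides are empty sums.\<close>

lemma sum_esym_remove:
  assumes "finite S"
  shows "(\<Sum>i\<in>S. esym k (S - {i}) l) = (real (card S) - real k) * esym k S l"
proof -
  have "(\<Sum>i\<in>S. esym k (S - {i}) l)
      = (\<Sum>i\<in>S. \<Sum>T | T \<in> {T. T \<subseteq> S \<and> card T = k} \<and> i \<notin> T. \<Prod>j\<in>T. l j)"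
    unfolding esym_def by (intro sum.cong refl) auto
  also have "\<dots> = (\<Sum>T | T \<subseteq> S \<and> card T = k. \<Sum>i | i \<in> S \<and> i \<notin> T. \<Prod>j\<in>T. l j)"
    using assms by (subst sum.swap_restrict) auto
  also have "\<dots> = (\<Sum>T | T \<subseteq> S \<and> card T = k. (real (card S) - real k) * (\<Prod>j\<in>T. l j))"
  proof (intro sum.cong refl)
    fix T assume T: "T \<in> {T. T \<subseteq> S \<and> card T = k}"
    then have "finite T" using assms finite_subset by auto
    have "card {i \<in> S. i \<notin> T} = card (S - T)" by (rule arg_cong[of _ _ card]) auto
    also have "\<dots> = card S - k" using T \<open>finite T\<close> by (simp add: card_Diff_subset)
    finally have "real (card {i \<in> S. i \<notin> T}) = real (card S) - real k"
      using T assms card_mono[of S T] by (simp add: of_nat_diff)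
    then show "(\<Sum>i | i \<in> S \<and> i \<notin> T. \<Prod>j\<in>T. l j) = (real (card S) - real k) * (\<Prod>j\<in>T. l j)"
      by simp
  qed
  finally show ?thesis by (simp add: esym_def sum_distrib_left)
qed

text \<open>Newton's inequality, for arbitrary real variables. In the induction, the inequality for two
  fewer variables is the real stability of the symmetric polynomial, which is then summed over all
  pairs.\<close>

lemma esym_newton:
  assumes "finite S"
  shows "esym m S l * esym (Suc (Suc m)) S l \<le> (esym (Suc m) S l)\<^sup>2 \<and>
    (esym m S l * esym (Suc (Suc m)) S l > 0 \<longrightarrow>
     esym m S l * esym (Suc (Suc m)) S l < (esym (Suc m) S l)\<^sup>2)"
  using assms
proof (induction "card S" arbitrary: S rule: less_induct)
  case less
  let ?a = "esym m S l" and ?b = "esym (Suc m) S l" and ?c = "esym (Suc (Suc m)) S l"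
  let ?n = "real (card S) - real (Suc m)"
  show ?case
  proof (cases "?a * ?c > 0")
    case False
    then have "?a * ?c \<le> ?b\<^sup>2" by (intro order_trans[OF _ zero_le_power2]) simp
    with False show ?thesis by blast
  next
    case True
    then have c0: "?c \<noteq> 0" by auto
    then have n: "Suc (Suc m) \<le> card S" using esym_eq_0[of S "Suc (Suc m)" l] less.prems by force
    \<comment> \<open>Write a, b, c for the values in degrees \<open>m\<close>,
      \<open>m + 1\<close>, \<open>m + 2\<close> on \<open>S - {i} - {j}\<close>. The right side
      minus the left side is b^2 - a c: all terms containing \<open>l i\<close> or
      \<open>l j\<close> cancel.\<close>
    have pair: "?c * esym m (S - {i} - {j}) l \<le> esym (Suc m) (S - {i}) l * esym (Suc m) (S - {j}) l"
      if ij: "i \<in> S" "j \<in> S - {i}" for i j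
    proof -
      let ?U = "S - {i} - {j}"
      have U: "S - {j} - {i} = ?U" by auto
      have "card ?U < card S" using ij less.prems by (intro psubset_card_mono) auto
      then have N: "esym m ?U l * esym (Suc (Suc m)) ?U l \<le> (esym (Suc m) ?U l)\<^sup>2"
        using less.hyps[of ?U] less.prems by auto
      have e: "?c = esym (Suc (Suc m)) ?U l + l j * esym (Suc m) ?U l
            + l i * (esym (Suc m) ?U l + l j * esym m ?U l)"
        "esym (Suc m) (S - {i}) l = esym (Suc m) ?U l + l j * esym m ?U l"
        "esym (Suc m) (S - {j}) l = esym (Suc m) ?U l + l i * esym m ?U l"
        using ij less.prems
          esym_Suc_remove[of S i "Suc m" l] esym_Suc_remove[of "S - {i}" j "Suc m" l]
          esym_Suc_remove[of "S - {i}" j m l] esym_Suc_remove[of "S - {j}" i m l] U by auto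
      show ?thesis unfolding e using N by (simp add: algebra_simps power2_eq_square)
    qed
    have s1: "(\<Sum>j\<in>S - {i}. esym m (S - {i} - {j}) l) = ?n * esym m (S - {i}) l" if "i \<in> S" for i
      using that sum_esym_remove[of "S - {i}" m l] less.prems n by (simp add: of_nat_diff algebra_simps)
    have s2: "(\<Sum>j\<in>S - {i}. esym (Suc m) (S - {j}) l) = ?n * ?b - esym (Suc m) (S - {i}) l" if "i \<in> S" for i
      using that sum_esym_remove[of S "Suc m" l] less.prems by (simp add: sum_diff1)
    have "(\<Sum>i\<in>S. \<Sum>j\<in>S - {i}. ?c * esym m (S - {i} - {j}) l)
       \<le> (\<Sum>i\<in>S. \<Sum>j\<in>S - {i}. esym (Suc m) (S - {i}) l * esym (Suc m) (S - {j}) l)"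
      by (intro sum_mono pair)
    also have "\<dots> = (\<Sum>i\<in>S. esym (Suc m) (S - {i}) l * (?n * ?b - esym (Suc m) (S - {i}) l))"
      by (intro sum.cong refl) (simp add: sum_distrib_left[symmetric] s2)
    also have "\<dots> = (\<Sum>i\<in>S. esym (Suc m) (S - {i}) l) * (?n * ?b) - (\<Sum>i\<in>S. (esym (Suc m) (S - {i}) l)\<^sup>2)"
      by (simp only: right_diff_distrib sum_subtractf sum_distrib_right power2_eq_square)
    also have "\<dots> \<le> ?n * (?n * ?b\<^sup>2)"
      using sum_esym_remove[of S "Suc m" l] less.prems
      by (simp add: sum_nonneg power2_eq_square mult.assoc mult.left_commute)
    finally have "(\<Sum>i\<in>S. \<Sum>j\<in>S - {i}. ?c * esym m (S - {i} - {j}) l) \<le> ?n * (?n * ?b\<^sup>2)" .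
    also have "(\<Sum>i\<in>S. \<Sum>j\<in>S - {i}. ?c * esym m (S - {i} - {j}) l) = ?c * (?n * (\<Sum>i\<in>S. esym m (S - {i}) l))"
      by (simp add: sum_distrib_left[symmetric] s1)
    \<comment> \<open>Removing one index counts a subset of size \<open>m\<close> with factor
      \<open>?n + 1\<close>, but one of size \<open>m + 1\<close> only with \<open>?n\<close>. This
      gap between the factors yields strictness when \<open>?a * ?c > 0\<close>.\<close>
    also have "\<dots> = ?n * ((?n + 1) * (?a * ?c))"
      using sum_esym_remove[of S m l] less.prems by simp
    finally have "?n * ((?n + 1) * (?a * ?c)) \<le> ?n * (?n * ?b\<^sup>2)" .
    moreover have n0: "?n > 0" using n by linarith
    ultimately have "(?n + 1) * (?a * ?c) \<le> ?n * ?b\<^sup>2" by (simp only: mult_le_cancel_left_pos)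
    moreover have "(?n + 1) * (?a * ?c) > ?n * (?a * ?c)" using True by (intro mult_strict_right_mono) auto
    ultimately have "?n * (?a * ?c) < ?n * ?b\<^sup>2" by linarith
    then have "?a * ?c < ?b\<^sup>2" using n0 by (simp only: mult_less_cancel_left_pos)
    then show ?thesis by simp
  qed
qed

text \<open>If \<open>?b \<le> 0\<close> in the induction step, add \<open>?a\<close> times the
  second expanded positivity to \<open>- ?b\<close> times the first: \<open>l i\<close> drops out
  and \<open>?a * ?c > ?b^2\<close> remains, contradicting Newton's inequality.\<close>

lemma esym_remove_pos:
  assumes "finite S" "i \<in> S" "\<And>j. j \<le> m + 1 \<Longrightarrow> esym j S l > 0"
  shows "esym m (S - {i}) l > 0"
  using assms(3)
proof (induction m)
  case 0
  then show ?case using assms by simp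
next
  case (Suc m)
  let ?a = "esym m (S - {i}) l" and ?b = "esym (Suc m) (S - {i}) l" and ?c = "esym (Suc (Suc m)) (S - {i}) l"
  have a: "?a > 0" using Suc by simp
  have 1: "?b + l i * ?a > 0" using Suc.prems[of "Suc m"] esym_Suc_remove[OF assms(1,2), of m l] by simp
  have 2: "?c + l i * ?b > 0" using Suc.prems[of "Suc (Suc m)"] esym_Suc_remove[OF assms(1,2), of "Suc m" l] by simp
  have N: "?a * ?c \<le> ?b\<^sup>2" using esym_newton[of "S - {i}" m l] assms by simp
  show ?case
  proof (rule ccontr)
    assume "\<not> ?b > 0"
    then have b: "- ?b \<ge> 0" by simp
    have "0 < ?a * (?c + l i * ?b)" using a 2 by simp
    moreover have "0 \<le> (- ?b) * (?b + l i * ?a)" using b 1 by (intro mult_nonneg_nonneg) auto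
    ultimately show False using N by (simp add: algebra_simps power2_eq_square)
  qed
qed

text \<open>The derivative of \<open>esym k S\<close> in the \<open>i\<close>-th variable. Degree 0
  is split off because truncated subtraction would give 1 instead of 0 there.\<close>

definition esym_partial :: "nat \<Rightarrow> 'a set \<Rightarrow> 'a \<Rightarrow> ('a \<Rightarrow> real) \<Rightarrow> real" where
  "esym_partial k S i l = (case k of 0 \<Rightarrow> 0 | Suc m \<Rightarrow> esym m (S - {i}) l)"

text \<open>The numerator of the derivative of \<open>- \<sigma>\<^sub>m / \<sigma>\<^sub>m\<^sub>+\<^sub>1\<close> with respect to the \<open>i\<close>-th variable.\<close>

definition ellip :: "nat \<Rightarrow> 'a set \<Rightarrow> 'a \<Rightarrow> ('a \<Rightarrow> real) \<Rightarrow> real" where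
  "ellip m S i l = esym m S l * esym_partial (Suc m) S i l - esym_partial m S i l * esym (Suc m) S l"

text \<open>Splitting off the variable \<open>i\<close> in both symmetric functions cancels
  \<open>l i\<close> and leaves \<open>?b^2 - ?a * ?c\<close> in the remaining variables. Newton is
  strict if \<open>?a * ?c > 0\<close>; otherwise \<open>?b > 0\<close> suffices.\<close>

lemma ellip_pos:
  assumes "finite S" "i \<in> S" "\<And>j. j \<le> Suc m \<Longrightarrow> esym j S l > 0"
  shows "ellip m S i l > 0"
proof (cases m)
  case 0
  then show ?thesis using assms by (simp add: ellip_def esym_partial_def)
next
  case (Suc r)
  let ?a = "esym r (S - {i}) l" and ?b = "esym (Suc r) (S - {i}) l" and ?c = "esym (Suc (Suc r)) (S - {i}) l"
  have a: "?a > 0" "?b > 0" using assms Suc by (auto intro!: esym_remove_pos)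
  have "?a * ?c < ?b\<^sup>2"
  proof (cases "?a * ?c > 0")
    case False
    moreover have "?b\<^sup>2 > 0" using a by simp
    ultimately show ?thesis by (intro le_less_trans[of "?a * ?c" 0]) auto
  qed (use esym_newton[of "S - {i}" r l] assms(1) in auto)
  moreover have "ellip m S i l = ?b\<^sup>2 - ?a * ?c"
    unfolding ellip_def esym_partial_def Suc using assms(1,2)
    by (simp add: esym_Suc_remove[of S i] algebra_simps power2_eq_square)
  ultimately show ?thesis by simp
qed

text \<open>The first part of \<open>ellip\<close> sums to \<open>card S - m\<close> times the
  square of \<open>esym m S l\<close>; the subtracted part is nonnegative and is dropped. Division
  by the squared \<open>esym (Suc m) S l\<close> gives the trace bound of the linearised
  operator.\<close>

lemma sum_ellip_le:
  assumes "finite S" "\<And>j. j \<le> Suc m \<Longrightarrow> esym j S l > 0"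
  shows "(\<Sum>i\<in>S. ellip m S i l) \<le> real (card S) * (esym m S l)\<^sup>2"
proof -
  have "(\<Sum>i\<in>S. esym_partial m S i l) \<ge> 0"
  proof (cases m)
    case (Suc r)
    have "esym r (S - {i}) l > 0" if "i \<in> S" for i
      using assms Suc that by (intro esym_remove_pos) auto
    then show ?thesis using Suc by (simp add: esym_partial_def sum_nonneg less_imp_le)
  qed (simp add: esym_partial_def)
  then have "(\<Sum>i\<in>S. esym_partial m S i l) * esym (Suc m) S l \<ge> 0"
    using assms(2)[of "Suc m"] by simp
  moreover have "(\<Sum>i\<in>S. ellip m S i l) = esym m S l * ((real (card S) - real m) * esym m S l)
      - (\<Sum>i\<in>S. esym_partial m S i l) * esym (Suc m) S l"
    using sum_esym_remove[OF assms(1), of m l]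
    by (simp add: ellip_def sum_subtractf sum_distrib_left[symmetric] sum_distrib_right[symmetric]
        esym_partial_def)
  moreover have "esym m S l * ((real (card S) - real m) * esym m S l) \<le> real (card S) * (esym m S l)\<^sup>2"
    by (simp add: algebra_simps power2_eq_square)
  ultimately show ?thesis by linarith
qed

lemma continuous_on_esym: "continuous_on S (\<lambda>l :: real^'n::finite. esym k T (($) l))"
  unfolding esym_def by (intro continuous_intros)

lemma continuous_on_ellip: "continuous_on S (\<lambda>l :: real^'n::finite. ellip k T i (($) l))"
  unfolding ellip_def esym_partial_def
  by (cases k) (auto intro!: continuous_intros continuous_on_esym)

subsection \<open>Eigenvalues of symmetric matrices\<close>

definition orthonormal :: "('n::finite \<Rightarrow> real^'n) \<Rightarrow> bool" where
  "orthonormal q \<longleftrightarrow> (\<forall>i j. q i \<bullet> q j = (if i = j then 1 else 0))"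

lemma linear_coeff_eq_0:
  fixes a b :: real
  assumes "\<And>t. a * t + b * t\<^sup>2 \<le> 0"
  shows "a = 0"
proof (rule ccontr)
  assume "a \<noteq> 0"
  \<comment> \<open>Chosen so that the linear term equals \<open>(1 + \<bar>b\<bar>) * t^2\<close>
    and dominates the quadratic one.\<close>
  define t where "t = a / (1 + \<bar>b\<bar>)"
  have "a = t * (1 + \<bar>b\<bar>)" by (simp add: t_def)
  then have "a * t + b * t\<^sup>2 = (1 + \<bar>b\<bar> + b) * t\<^sup>2" by (simp add: algebra_simps power2_eq_square)
  moreover have "t \<noteq> 0" using \<open>a \<noteq> 0\<close> by (simp add: t_def)
  then have "(1 + \<bar>b\<bar> + b) * t\<^sup>2 > 0" by (intro mult_pos_pos) auto
  ultimately show False using assms[of t] by linarith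
qed

lemma symmetric_inner_commute:
  fixes A :: "real^'n^'n"
  assumes "transpose A = A"
  shows "x \<bullet> (A *v y) = y \<bullet> (A *v x)"
  by (metis assms dot_lmul_matrix inner_commute transpose_matrix_vector)

text \<open>Maximise the quadratic form on the unit sphere of \<open>W\<close>. First-order
  optimality makes \<open>A *v v - d *\<^sub>R v\<close> orthogonal to \<open>W\<close>; by
  invariance it also lies in \<open>W\<close>, so it vanishes.\<close>

lemma symmetric_eigenvector_in_subspace:
  fixes A :: "real^'n::finite^'n"
  assumes sym: "transpose A = A" and W: "subspace W" and inv: "\<And>x. x \<in> W \<Longrightarrow> A *v x \<in> W"
    and x0: "x0 \<in> W" "x0 \<noteq> 0"
  shows "\<exists>v\<in>W. \<exists>d. norm v = 1 \<and> A *v v = d *\<^sub>R v"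
proof -
  let ?f = "\<lambda>x. x \<bullet> (A *v x)"
  have "compact (W \<inter> sphere 0 1)" using W by (intro closed_Int_compact closed_subspace) auto
  moreover have "(1 / norm x0) *\<^sub>R x0 \<in> W \<inter> sphere 0 1"
    using x0 W by (auto intro: subspace_scale)
  then have "W \<inter> sphere 0 1 \<noteq> {}" by blast
  moreover have "continuous_on (W \<inter> sphere 0 1) ?f"
    by (intro continuous_intros matrix_vector_mult_linear_continuous_on)
  ultimately obtain v where "v \<in> W \<inter> sphere 0 1" "\<forall>x\<in>W \<inter> sphere 0 1. ?f x \<le> ?f v"
    using continuous_attains_sup[of "W \<inter> sphere 0 1" ?f] by blast
  then have v: "v \<in> W" "norm v = 1" and
    max: "\<And>x. x \<in> W \<Longrightarrow> norm x = 1 \<Longrightarrow> ?f x \<le> ?f v" by auto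
  define d where "d = ?f v"
  have le: "?f x \<le> d * (x \<bullet> x)" if "x \<in> W" for x
  proof (cases "x = 0")
    case False
    let ?y = "(1 / norm x) *\<^sub>R x"
    have "?f ?y \<le> d" unfolding d_def using that W False by (intro max subspace_scale) auto
    moreover have "?f ?y = ?f x / (norm x)\<^sup>2"
      by (simp add: matrix_vector_mult_scaleR power2_eq_square)
    ultimately have "?f x / (norm x)\<^sup>2 \<le> d" by (simp only:)
    then show ?thesis using False by (simp add: divide_le_eq flip: power2_norm_eq_inner)
  qed simp
  have orth: "w \<bullet> (A *v v - d *\<^sub>R v) = 0" if w: "w \<in> W" for w
  proof -
    have "2 * (w \<bullet> (A *v v - d *\<^sub>R v)) * t + (?f w - d * (w \<bullet> w)) * t\<^sup>2 \<le> 0" for t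
    proof -
      have "v + t *\<^sub>R w \<in> W" using v w W by (intro subspace_add subspace_scale)
      from le[OF this] have "?f (v + t *\<^sub>R w) \<le> d * ((v + t *\<^sub>R w) \<bullet> (v + t *\<^sub>R w))" .
      moreover have "?f (v + t *\<^sub>R w) = d + 2 * t * (w \<bullet> (A *v v)) + t\<^sup>2 * ?f w"
        using symmetric_inner_commute[OF sym, of v w]
        by (simp add: matrix_vector_right_distrib matrix_vector_mult_scaleR inner_add_left
            inner_add_right power2_eq_square d_def algebra_simps)
      moreover have "(v + t *\<^sub>R w) \<bullet> (v + t *\<^sub>R w) = 1 + 2 * t * (w \<bullet> v) + t\<^sup>2 * (w \<bullet> w)"
        using v by (simp add: norm_eq_1 inner_add_left inner_add_right power2_eq_square
            inner_commute[of v w] algebra_simps)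
      ultimately have "d + 2 * t * (w \<bullet> (A *v v)) + t\<^sup>2 * ?f w
          \<le> d * (1 + 2 * t * (w \<bullet> v) + t\<^sup>2 * (w \<bullet> w))" by simp
      then show ?thesis unfolding inner_diff_right inner_scaleR_right by argo
    qed
    from linear_coeff_eq_0[OF this] show ?thesis by simp
  qed
  have "A *v v - d *\<^sub>R v \<in> W" using v W inv by (intro subspace_diff subspace_scale) auto
  from orth[OF this] show ?thesis using v by auto
qed

text \<open>Eigenvectors are found one index at a time: the orthogonal complement of those already
  found is invariant by symmetry, and nonzero while fewer than \<open>CARD('n)\<close> indices are
  used.\<close>

lemma spectral_theorem:
  fixes A :: "real^'n::finite^'n"
  assumes sym: "transpose A = A"
  shows "\<exists>q d. orthonormal q \<and> (\<forall>i. A *v q i = d i *\<^sub>R q i)"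
proof -
  have "\<exists>q d. (\<forall>i\<in>I. \<forall>j\<in>I. q i \<bullet> q j = (if i = j then 1 else 0)) \<and> (\<forall>i\<in>I. A *v q i = d i *\<^sub>R q i)"
    for I :: "'n set"
  proof (induction I rule: infinite_finite_induct)
    case (insert a I)
    then obtain q d where q: "\<And>i j. i \<in> I \<Longrightarrow> j \<in> I \<Longrightarrow> q i \<bullet> q j = (if i = j then 1 else 0)"
      "\<And>i. i \<in> I \<Longrightarrow> A *v q i = d i *\<^sub>R q i" by blast
    define W where "W = {x. \<forall>i\<in>I. q i \<bullet> x = 0}"
    have W: "subspace W" by (auto simp: W_def subspace_def inner_add_right)
    have inv: "A *v x \<in> W" if "x \<in> W" for x
    proof -
      have "q i \<bullet> (A *v x) = 0" if "i \<in> I" for i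
        using symmetric_inner_commute[OF sym, of "q i" x] q(2)[OF that] \<open>x \<in> W\<close> that
        by (simp add: W_def inner_commute)
      then show ?thesis by (simp add: W_def)
    qed
    have "dim (span (q ` I)) \<le> card (q ` I)"
      by (simp add: dim_le_card')
    also have "\<dots> \<le> card I" using insert by (simp add: card_image_le)
    also have "\<dots> < card (UNIV :: 'n set)" using insert by (intro psubset_card_mono) auto
    finally have "dim (span (q ` I)) < DIM(real^'n)" by simp
    then obtain x0 where x0: "x0 \<noteq> 0" "\<And>y. y \<in> span (q ` I) \<Longrightarrow> orthogonal x0 y"
      using orthogonal_to_subspace_exists[of "q ` I"] by (auto simp: dim_span)
    have "q i \<bullet> x0 = 0" if "i \<in> I" for i
      using x0(2)[OF span_base[OF imageI[OF that]]] by (simp add: orthogonal_def inner_commute)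
    then have "x0 \<in> W" "x0 \<noteq> 0" using x0 by (auto simp: W_def)
    from symmetric_eigenvector_in_subspace[OF sym W inv this]
    obtain v e where v: "v \<in> W" "norm v = 1" "A *v v = e *\<^sub>R v" by blast
    have "v \<bullet> v = 1" using v by (simp add: norm_eq_1)
    then show ?case using q v insert
      by (intro exI[of _ "q(a := v)"] exI[of _ "d(a := e)"]) (auto simp: W_def inner_commute)
  qed auto
  from this[of UNIV] show ?thesis by (simp add: orthonormal_def)
qed

section \<open>Characteristic polynomials and eigenbases\<close>

lemma poly_det: "poly (det P) z = det (\<chi> i j. poly (P $ i $ j) z)"
  by (simp add: det_def poly_sum poly_prod)

lemma poly_charpoly: "poly (charpoly A) z = det (mat z - A)"
  unfolding charpoly_def poly_det by (rule arg_cong[of _ _ det]) (simp add: vec_eq_iff mat_def)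

lemma matrix_diff_ldistrib: "A ** (B - C) = A ** B - A ** (C :: real^'n^'m)"
  by (simp add: matrix_matrix_mult_def vec_eq_iff sum_subtractf right_diff_distrib)

lemma matrix_diff_rdistrib: "(B - C) ** A = B ** A - (C :: real^'m^'n) ** A"
  by (simp add: matrix_matrix_mult_def vec_eq_iff sum_subtractf left_diff_distrib)

text \<open>Equality is tested at every real \<open>z\<close>, where it is multiplicativity of real
  determinants. \<open>M\<close> is arbitrary, so a whole curve of matrices can be conjugated by an
  eigenbasis of its value at 0.\<close>

lemma charpoly_orthonormal_conj:
  fixes M :: "real^'n::finite^'n"
  assumes q: "orthonormal q"
  shows "charpoly (\<chi> i j. q i \<bullet> (M *v q j)) = charpoly M"
proof -
  define Q :: "real^'n^'n" where "Q = (\<chi> i j. q j $ i)"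
  have QQ: "transpose Q ** Q = mat 1"
    using q by (simp add: orthonormal_def vec_eq_iff matrix_matrix_mult_def transpose_def Q_def
        inner_vec_def mat_def)
  have "poly (charpoly (\<chi> i j. q i \<bullet> (M *v q j))) z = poly (charpoly M) z" for z
  proof -
    have "mat z - (\<chi> i j. q i \<bullet> (M *v q j)) = transpose Q ** (mat z - M) ** Q"
    proof -
      have "(\<chi> i j. q i \<bullet> (M *v q j)) = transpose Q ** M ** Q"
        unfolding matrix_mul_assoc[symmetric]
        by (simp add: vec_eq_iff matrix_matrix_mult_def transpose_def Q_def inner_vec_def
            matrix_vector_mult_def)
      moreover have "mat z = transpose Q ** mat z ** Q"
      proof -
        have "mat z = z *\<^sub>R (mat 1 :: real^'n^'n)" by (simp add: vec_eq_iff mat_def)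
        then show ?thesis using QQ
          by (simp add: matrix_scalar_ac scalar_matrix_assoc[symmetric])
      qed
      ultimately show ?thesis by (simp add: matrix_diff_ldistrib matrix_diff_rdistrib)
    qed
    moreover have "det (transpose Q) * det Q = 1" by (metis QQ det_I det_mul)
    ultimately show ?thesis by (simp add: poly_charpoly det_mul)
  qed
  then show ?thesis by (simp add: poly_eq_poly_eq_iff fun_eq_iff flip: poly_eq_poly_eq_iff)
qed

lemma charpoly_diagonal:
  fixes M :: "real^'n::finite^'n"
  assumes "\<And>i j. i \<noteq> j \<Longrightarrow> M $ i $ j = 0"
  shows "charpoly M = (\<Prod>i\<in>UNIV. [:- (M $ i $ i), 1:])"
  unfolding charpoly_def using assms by (subst det_diagonal) (auto simp: mat_def)

lemma charpoly_eigenbasis: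
  assumes q: "orthonormal q" and A: "\<And>i. A *v q i = d i *\<^sub>R q i"
  shows "charpoly A = (\<Prod>i\<in>UNIV. [:- d i, 1:])"
proof -
  have "charpoly A = charpoly (\<chi> i j. q i \<bullet> (A *v q j))" by (simp add: charpoly_orthonormal_conj q)
  also have "\<dots> = (\<Prod>i\<in>UNIV. [:- d i, 1:])"
    using q by (subst charpoly_diagonal) (auto simp: A orthonormal_def)
  finally show ?thesis .
qed

text \<open>The choice in \<open>eigenvals\<close> is pinned down only as a multiset, so a basis
  from the spectral theorem is permuted to match the chosen order.\<close>

lemma ex_eigenvals_basis:
  fixes A :: "real^'n::finite^'n"
  assumes sym: "transpose A = A"
  shows "\<exists>q. orthonormal q \<and> (\<forall>i. A *v q i = (eigenvals A $ i) *\<^sub>R q i)"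
proof -
  obtain q d where q: "orthonormal q" "\<And>i. A *v q i = d i *\<^sub>R q i"
    using spectral_theorem[OF sym] by blast
  have "proots (charpoly A) = (\<Sum>i\<in>UNIV. {#d i#})"
    unfolding charpoly_eigenbasis[OF q] by (subst proots_prod) auto
  also have "\<dots> = image_mset d (mset_set UNIV)"
    by (simp add: sum_unfold_sum_mset)
  finally have pr: "image_mset d (mset_set UNIV) = proots (charpoly A)" ..
  have "image_mset (\<lambda>i. eigenvals A $ i) (mset_set UNIV) = proots (charpoly A)"
    unfolding eigenvals_def by (rule someI[of _ "\<chi> i. d i"]) (simp add: pr)
  with pr obtain p where p: "p permutes UNIV" "\<And>i. eigenvals A $ i = d (p i)"
    using image_mset_eq_implies_permutes[of UNIV "\<lambda>i. eigenvals A $ i" d] by auto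
  have "p i = p j \<longleftrightarrow> i = j" for i j using permutes_inj[OF p(1)] by (auto dest: injD)
  then show ?thesis using q p(2) by (intro exI[of _ "q \<circ> p"]) (auto simp: orthonormal_def)
qed

text \<open>The elementary symmetric polynomials of the eigenvalues, as polynomials in the matrix entries.\<close>

definition csym :: "nat \<Rightarrow> real^'n::finite^'n \<Rightarrow> real" where
  "csym k A = (-1) ^ k * coeff (charpoly A) (CARD('n) - k)"

lemma coeff_prod_linear:
  assumes "finite S" "k \<le> card S"
  shows "coeff (\<Prod>i\<in>S. [:- l i, 1:]) (card S - k) = (-1) ^ k * esym k S l"
proof -
  have "(\<Prod>i\<in>S. [:- l i, 1:]) = (\<Prod>i\<in>S. [:- l i:] + [:0, 1:])" by simp
  also have "\<dots> = (\<Sum>X\<in>Pow S. (\<Prod>i\<in>X. [:- l i:]) * (\<Prod>i\<in>S - X. [:0, 1:]))"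
    by (rule prod_add[OF assms(1)])
  also have "\<dots> = (\<Sum>X\<in>Pow S. monom ((-1) ^ card X * (\<Prod>i\<in>X. l i)) (card S - card X))"
  proof (intro sum.cong refl)
    fix X assume "X \<in> Pow S"
    then have X: "X \<subseteq> S" "finite X" using assms finite_subset by auto
    have "(\<Prod>i\<in>X. [:- l i:]) = [:\<Prod>i\<in>X. - l i:]"
      using X(2) by (induction X rule: finite_induct) auto
    also have "(\<Prod>i\<in>X. - l i) = (-1) ^ card X * (\<Prod>i\<in>X. l i)"
      using X(2) by (simp add: prod_uminus)
    finally have "(\<Prod>i\<in>X. [:- l i:]) = [:(-1) ^ card X * (\<Prod>i\<in>X. l i):]" .
    then show "(\<Prod>i\<in>X. [:- l i:]) * (\<Prod>i\<in>S - X. [:0, 1:])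
        = monom ((-1) ^ card X * (\<Prod>i\<in>X. l i)) (card S - card X)"
      using X by (simp add: card_Diff_subset monom_altdef)
  qed
  finally have "coeff (\<Prod>i\<in>S. [:- l i, 1:]) (card S - k) =
     (\<Sum>X\<in>Pow S. if card S - card X = card S - k then (-1) ^ card X * (\<Prod>i\<in>X. l i) else 0)"
    by (simp add: coeff_sum)
  also have "\<dots> = (\<Sum>X\<in>Pow S. if card X = k then (-1) ^ k * (\<Prod>i\<in>X. l i) else 0)"
  proof (intro sum.cong refl)
    fix X assume "X \<in> Pow S"
    then have "card X \<le> card S" using assms card_mono by auto
    then have "card S - card X = card S - k \<longleftrightarrow> card X = k" using assms by auto
    then show "(if card S - card X = card S - k then (-1) ^ card X * (\<Prod>i\<in>X. l i) else 0)
      = (if card X = k then (-1) ^ k * (\<Prod>i\<in>X. l i) else 0)" by simp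
  qed
  also have "\<dots> = (\<Sum>X | X \<in> Pow S \<and> card X = k. (-1) ^ k * (\<Prod>i\<in>X. l i))"
    using assms by (subst sum.inter_filter[symmetric]) auto
  finally show ?thesis by (simp add: esym_def sum_distrib_left)
qed

lemma csym_eigenbasis:
  fixes A :: "real^'n::finite^'n"
  assumes "orthonormal q" "\<And>i. A *v q i = d i *\<^sub>R q i" "k \<le> CARD('n)"
  shows "csym k A = esym k UNIV d"
  using coeff_prod_linear[of UNIV k d] assms(3)
  by (simp add: csym_def charpoly_eigenbasis[OF assms(1,2)] flip: mult.assoc power_mult_distrib)

text \<open>The derivative at 0 of a curve of polynomials, taken coefficientwise, so that sum and
  product rules apply to the characteristic polynomial as a whole.\<close>

definition coeff_deriv :: "(real \<Rightarrow> real poly) \<Rightarrow> real poly \<Rightarrow> bool" where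
  "coeff_deriv f f' \<longleftrightarrow> (\<forall>k. ((\<lambda>t. coeff (f t) k) has_real_derivative coeff f' k) (at 0))"

lemma coeff_deriv_const: "coeff_deriv (\<lambda>t. p) 0"
  by (simp add: coeff_deriv_def)

lemma coeff_deriv_mult:
  assumes "coeff_deriv f f'" "coeff_deriv g g'"
  shows "coeff_deriv (\<lambda>t. f t * g t) (f' * g 0 + f 0 * g')"
  unfolding coeff_deriv_def
proof
  fix k
  have "((\<lambda>t. \<Sum>i\<le>k. coeff (f t) i * coeff (g t) (k - i)) has_real_derivative
      (\<Sum>i\<le>k. coeff (f 0) i * coeff g' (k - i) + coeff f' i * coeff (g 0) (k - i))) (at 0)"
    using assms by (intro DERIV_sum DERIV_mult') (auto simp: coeff_deriv_def)
  then show "((\<lambda>t. coeff (f t * g t) k) has_real_derivative coeff (f' * g 0 + f 0 * g') k) (at 0)"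
    by (simp add: coeff_mult sum.distrib add.commute)
qed

lemma coeff_deriv_sum:
  "(\<And>i. i \<in> S \<Longrightarrow> coeff_deriv (f i) (f' i)) \<Longrightarrow> coeff_deriv (\<lambda>t. \<Sum>i\<in>S. f i t) (\<Sum>i\<in>S. f' i)"
  by (auto simp: coeff_deriv_def coeff_sum intro!: DERIV_sum)

lemma coeff_deriv_prod:
  assumes "finite S" "\<And>i. i \<in> S \<Longrightarrow> coeff_deriv (f i) (f' i)"
  shows "coeff_deriv (\<lambda>t. \<Prod>i\<in>S. f i t) (\<Sum>i\<in>S. f' i * (\<Prod>j\<in>S - {i}. f j 0))"
  using assms
proof (induction S rule: finite_induct)
  case empty
  then show ?case by (simp add: coeff_deriv_const)
next
  case (insert a S)
  have "coeff_deriv (\<lambda>t. f a t * (\<Prod>i\<in>S. f i t))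
      (f' a * (\<Prod>i\<in>S. f i 0) + f a 0 * (\<Sum>i\<in>S. f' i * (\<Prod>j\<in>S - {i}. f j 0)))"
    using insert by (intro coeff_deriv_mult) auto
  moreover have "(\<Sum>i\<in>S. f' i * (\<Prod>j\<in>insert a S - {i}. f j 0))
      = (\<Sum>i\<in>S. f a 0 * (f' i * (\<Prod>j\<in>S - {i}. f j 0)))"
  proof (intro sum.cong refl)
    fix i assume that: "i \<in> S"
    have "insert a S - {i} = insert a (S - {i})" using insert that by auto
    then show "f' i * (\<Prod>j\<in>insert a S - {i}. f j 0) = f a 0 * (f' i * (\<Prod>j\<in>S - {i}. f j 0))"
      using insert by (simp add: mult.left_commute)
  qed
  moreover have "insert a S - {a} = S" using insert by auto
  ultimately show ?case using insert by (simp add: sum_distrib_left)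
qed

text \<open>Jacobi's formula at a diagonal matrix. A permutation other than the identity moves at
  least two indices, so after one factor is differentiated another off-diagonal factor is left to
  vanish.\<close>

lemma coeff_deriv_det_diagonal:
  fixes P :: "real \<Rightarrow> real poly^'n::finite^'n"
  assumes P: "\<And>i j. coeff_deriv (\<lambda>t. P t $ i $ j) (P' i j)"
    and diag: "\<And>i j. i \<noteq> j \<Longrightarrow> P 0 $ i $ j = 0"
  shows "coeff_deriv (\<lambda>t. det (P t)) (\<Sum>i\<in>UNIV. P' i i * (\<Prod>j\<in>UNIV - {i}. P 0 $ j $ j))"
proof -
  let ?D = "\<lambda>p. \<Sum>i\<in>UNIV. P' i (p i) * (\<Prod>j\<in>UNIV - {i}. P 0 $ j $ p j)"
  let ?U = "UNIV :: 'n set"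
  have "coeff_deriv (\<lambda>t. \<Sum>p | p permutes ?U. of_int (sign p) * (\<Prod>i\<in>UNIV. P t $ i $ p i))
     (\<Sum>p | p permutes ?U. 0 * (\<Prod>i\<in>UNIV. P 0 $ i $ p i) + of_int (sign p) * ?D p)"
    by (intro coeff_deriv_sum coeff_deriv_mult coeff_deriv_const coeff_deriv_prod P) auto
  moreover have "?D p = 0" if p: "p permutes ?U" "p \<noteq> id" for p
  proof -
    obtain a where a: "p a \<noteq> a" using p(2) by (auto simp: fun_eq_iff)
    have pp: "p (p a) \<noteq> p a" using a permutes_inj[OF p(1)] by (auto dest: injD)
    have "(\<Prod>j\<in>UNIV - {i}. P 0 $ j $ p j) = 0" for i
    proof -
      obtain j where "j \<noteq> i" "p j \<noteq> j" using a pp by metis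
      then show ?thesis using diag[of j "p j"] by (intro prod_zero) auto
    qed
    then show ?thesis by (simp only: mult_zero_right sum.neutral_const)
  qed
  then have "(\<Sum>p | p permutes ?U. 0 * (\<Prod>i\<in>UNIV. P 0 $ i $ p i) + of_int (sign p) * ?D p)
      = (\<Sum>p\<in>{id}. of_int (sign p) * ?D p)"
    by (intro sum.mono_neutral_cong_right) (auto simp: permutes_id)
  ultimately show ?thesis by (simp add: det_def sign_id)
qed

text \<open>First-order perturbation of symmetric functions of the eigenvalues without
  differentiating an eigenvalue: in the basis \<open>q\<close> the matrix at 0 is diagonal, so only
  the diagonal entries of \<open>M'\<close> contribute. Multiple eigenvalues cause no
  difficulty.\<close>

lemma csym_deriv:
  fixes M :: "real \<Rightarrow> real^'n::finite^'n"
  assumes M: "\<And>i j. ((\<lambda>t. M t $ i $ j) has_real_derivative M' $ i $ j) (at 0)"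
    and q: "orthonormal q" "\<And>i. M 0 *v q i = l i *\<^sub>R q i" and k: "k \<le> CARD('n)"
  shows "((\<lambda>t. csym k (M t)) has_real_derivative
    (\<Sum>i\<in>UNIV. (q i \<bullet> (M' *v q i)) * esym_partial k UNIV i l)) (at 0)"
proof -
  let ?n = "CARD('n)"
  let ?N = "\<lambda>t. (\<chi> i j. q i \<bullet> (M t *v q j)) :: real^'n^'n"
  let ?P = "\<lambda>t. mat [:0, 1:] - (\<chi> i j. [:?N t $ i $ j:]) :: real poly^'n^'n"
  let ?C = "\<Sum>i\<in>UNIV. [:- (q i \<bullet> (M' *v q i)):] * (\<Prod>j\<in>UNIV - {i}. ?P 0 $ j $ j)"
  have ent: "((\<lambda>t. q i \<bullet> (M t *v q j)) has_real_derivative q i \<bullet> (M' *v q j)) (at 0)" for i j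
    unfolding inner_vec_def matrix_vector_mult_def
    by (auto intro!: derivative_eq_intros M simp: mult.commute)
  have "coeff_deriv (\<lambda>t. ?P t $ i $ j) [:- (q i \<bullet> (M' *v q j)):]" for i j
    unfolding coeff_deriv_def
  proof
    fix r
    have "coeff (?P t $ i $ j) r
        = coeff (mat [:0, 1:] $ i $ j) r - (if r = 0 then q i \<bullet> (M t *v q j) else 0)" for t
      by (simp add: coeff_pCons split: nat.split)
    then show "((\<lambda>t. coeff (?P t $ i $ j) r) has_real_derivative
        coeff [:- (q i \<bullet> (M' *v q j)):] r) (at 0)"
      using DERIV_diff[OF DERIV_const ent[of i j]] by (cases r) simp_all
  qed
  moreover have "?P 0 $ i $ j = 0" if "i \<noteq> j" for i j
    using that q by (simp add: mat_def orthonormal_def)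
  ultimately have "coeff_deriv (\<lambda>t. det (?P t)) ?C"
    by (rule coeff_deriv_det_diagonal[where P = ?P])
  moreover have "det (?P t) = charpoly (M t)" for t
    using charpoly_orthonormal_conj[OF q(1), of "M t"] by (simp only: charpoly_def)
  ultimately have "coeff_deriv (\<lambda>t. charpoly (M t)) ?C" by simp
  then have "((\<lambda>t. csym k (M t)) has_real_derivative (-1) ^ k * coeff ?C (?n - k)) (at 0)"
    unfolding csym_def coeff_deriv_def by (intro DERIV_cmult) blast
  moreover have "(-1) ^ k * coeff ?C (?n - k) = (\<Sum>i\<in>UNIV. (q i \<bullet> (M' *v q i)) * esym_partial k UNIV i l)"
  proof -
    have "?P 0 $ j $ j = [:- l j, 1:]" for j
      using q by (simp add: mat_def orthonormal_def)
    then have "coeff ?C (?n - k) = (\<Sum>i\<in>UNIV. - (q i \<bullet> (M' *v q i)) *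
        coeff (\<Prod>j\<in>UNIV - {i}. [:- l j, 1:]) (?n - k))"
      by (simp add: coeff_sum)
    also have "\<dots> = (\<Sum>i\<in>UNIV. (-1) ^ k * ((q i \<bullet> (M' *v q i)) * esym_partial k UNIV i l))"
    proof (intro sum.cong refl)
      fix i :: 'n
      have c: "card (UNIV - {i} :: 'n set) = ?n - 1" by simp
      have "- coeff (\<Prod>j\<in>UNIV - {i}. [:- l j, 1:]) (?n - k) = (-1) ^ k * esym_partial k UNIV i l"
      proof (cases k)
        \<comment> \<open>The coefficient of degree \<open>?n\<close> in a product of
          \<open>?n - 1\<close> linear factors is zero, matching the value of
          \<open>esym_partial\<close> in degree 0.\<close>
        case 0
        have "degree (\<Prod>j\<in>UNIV - {i}. [:- l j, 1:]) \<le> (\<Sum>j\<in>UNIV - {i}. degree [:- l j, 1:])"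
          by (rule order_trans[OF degree_prod_sum_le]) simp_all
        also have "\<dots> = ?n - 1" using c by simp
        also have "\<dots> < ?n" by simp
        finally show ?thesis using 0 by (simp add: esym_partial_def coeff_eq_0)
      next
        case (Suc m)
        have "?n - k = card (UNIV - {i} :: 'n set) - m" using Suc c by simp
        then show ?thesis using coeff_prod_linear[of "UNIV - {i}" m l] Suc k c
          by (simp add: esym_partial_def)
      qed
      then show "- (q i \<bullet> (M' *v q i)) * coeff (\<Prod>j\<in>UNIV - {i}. [:- l j, 1:]) (?n - k)
          = (-1) ^ k * ((q i \<bullet> (M' *v q i)) * esym_partial k UNIV i l)"
        by (metis (no_types, lifting) mult.left_commute mult_minus_left mult_minus_right)
    qed
    finally have c: "coeff ?C (?n - k)
        = (\<Sum>i\<in>UNIV. (-1) ^ k * ((q i \<bullet> (M' *v q i)) * esym_partial k UNIV i l))" .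
    have "(-1) ^ k * ((-1) ^ k * y) = y" for y :: real
      by (simp flip: mult.assoc power_mult_distrib)
    then show ?thesis unfolding c sum_distrib_left by simp
  qed
  ultimately show ?thesis by simp
qed

lemma continuous_on_coeff_prod:
  fixes f :: "'i \<Rightarrow> 'a::topological_space \<Rightarrow> real poly"
  assumes "finite S" "\<And>i k. i \<in> S \<Longrightarrow> continuous_on T (\<lambda>x. coeff (f i x) k)"
  shows "continuous_on T (\<lambda>x. coeff (\<Prod>i\<in>S. f i x) k)"
  using assms
  by (induction S arbitrary: k rule: finite_induct)
    (auto simp: coeff_mult intro!: continuous_intros)

lemma continuous_on_csym:
  fixes M :: "'a::topological_space \<Rightarrow> real^'n::finite^'n"
  assumes M: "\<And>i j. continuous_on T (\<lambda>x. M x $ i $ j)"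
  shows "continuous_on T (\<lambda>x. csym k (M x))"
proof -
  have "continuous_on T (\<lambda>x. coeff ((mat [:0, 1:] - (\<chi> i j. [:M x $ i $ j:])) $ i $ j) r)" for i j r
    by (cases r) (auto intro!: continuous_on_diff continuous_on_const M)
  moreover have "coeff (of_int a * p) r = of_int a * coeff p r" for a r and p :: "real poly"
    by (simp add: of_int_poly)
  ultimately show ?thesis
    unfolding csym_def charpoly_def det_def
    by (auto simp: coeff_sum intro!: continuous_intros continuous_on_coeff_prod)
qed

subsection \<open>Partial derivatives\<close>

lemma has_derivative_partial:
  assumes "f differentiable (at x)"
  shows "(f has_derivative (\<lambda>v. \<Sum>i\<in>UNIV. v $ i * partial_deriv i f x)) (at x)"
proof -
  let ?F = "frechet_derivative f (at x)"
  have F: "(f has_derivative ?F) (at x)" using assms frechet_derivative_works by blast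
  then interpret linear ?F by (rule has_derivative_linear)
  have "?F v = (\<Sum>i\<in>UNIV. v $ i * partial_deriv i f x)" for v
  proof -
    have "?F v = ?F (\<Sum>i\<in>UNIV. v $ i *\<^sub>R axis i 1)" by (simp add: basis_expansion flip: scalar_mult_eq_scaleR)
    then show ?thesis by (simp add: sum scale partial_deriv_def)
  qed
  then show ?thesis using F by presburger
qed

lemma partial_deriv_eqI: "(f has_derivative F) (at x) \<Longrightarrow> partial_deriv i f x = F (axis i 1)"
  unfolding partial_deriv_def by (metis frechet_derivative_at)

lemma line_deriv:
  assumes "\<And>x. f differentiable (at x)"
  shows "((\<lambda>t. f (p + t *\<^sub>R v)) has_real_derivative
    (\<Sum>i\<in>UNIV. v $ i * partial_deriv i f (p + t *\<^sub>R v))) (at t)"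
proof -
  have "((\<lambda>t. p + t *\<^sub>R v) has_derivative (\<lambda>h. h *\<^sub>R v)) (at t)"
    by (auto intro!: derivative_eq_intros)
  from has_derivative_compose[OF this has_derivative_partial[OF assms]]
  have "((\<lambda>t. f (p + t *\<^sub>R v)) has_derivative
      (\<lambda>h. \<Sum>i\<in>UNIV. (h *\<^sub>R v) $ i * partial_deriv i f (p + t *\<^sub>R v))) (at t)" .
  moreover have "(\<lambda>h. \<Sum>i\<in>UNIV. (h *\<^sub>R v) $ i * partial_deriv i f (p + t *\<^sub>R v))
      = (*) (\<Sum>i\<in>UNIV. v $ i * partial_deriv i f (p + t *\<^sub>R v))"
    by (simp add: fun_eq_iff sum_distrib_left mult_ac)
  ultimately show ?thesis by (simp only: has_field_derivative_def)
qed

lemma smooth_fun_differentiable: "smooth_fun f \<Longrightarrow> f differentiable (at x)"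
  unfolding smooth_fun_def by (drule spec[of _ "Suc 0"]) simp

lemma smooth_fun_partial: "smooth_fun f \<Longrightarrow> smooth_fun (partial_deriv i f)"
  unfolding smooth_fun_def
proof
  fix m assume "\<forall>m. C_diff m f"
  then have "C_diff (Suc m) f" by blast
  then show "C_diff m (partial_deriv i f)" by simp
qed

lemma smooth_fun_isCont: "smooth_fun f \<Longrightarrow> isCont f x"
  by (intro differentiable_imp_continuous_within smooth_fun_differentiable)

lemma partial_deriv_line:
  assumes "smooth_fun f"
  shows "((\<lambda>t. f (p + t *\<^sub>R axis i 1)) has_real_derivative partial_deriv i f (p + t *\<^sub>R axis i 1)) (at t)"
proof -
  have "(\<Sum>j\<in>UNIV. axis i 1 $ j * partial_deriv j f y) = partial_deriv i f y" for y
    by (simp add: axis_def if_distrib if_distribR cong: if_cong)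
  then show ?thesis using line_deriv[OF smooth_fun_differentiable[OF assms], of p "axis i 1" t] by simp
qed

text \<open>The mixed second difference is symmetric in \<open>i\<close> and \<open>j\<close>,
  whereas two mean value theorems turn it into one particular order of differentiation. Comparing
  the two orders gives Schwarz's theorem.\<close>

lemma second_difference:
  fixes f :: "real^'n::finite \<Rightarrow> real"
  assumes f: "smooth_fun f" and h: "h > 0"
  shows "\<exists>s t. 0 < s \<and> s < h \<and> 0 < t \<and> t < h \<and>
    f (x + h *\<^sub>R axis i 1 + h *\<^sub>R axis j 1) - f (x + h *\<^sub>R axis i 1) - f (x + h *\<^sub>R axis j 1) + f x
      = h * (h * partial_deriv j (partial_deriv i f) (x + s *\<^sub>R axis i 1 + t *\<^sub>R axis j 1))"
proof -
  let ?g = "\<lambda>s. f (x + h *\<^sub>R axis j 1 + s *\<^sub>R axis i 1) - f (x + s *\<^sub>R axis i 1)"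
  have "(?g has_real_derivative partial_deriv i f (x + h *\<^sub>R axis j 1 + s *\<^sub>R axis i 1)
      - partial_deriv i f (x + s *\<^sub>R axis i 1)) (at s)" for s
    by (intro DERIV_diff partial_deriv_line f)
  from MVT2[OF h this] obtain s where s: "0 < s" "s < h"
    "?g h - ?g 0 = (h - 0) * (partial_deriv i f (x + h *\<^sub>R axis j 1 + s *\<^sub>R axis i 1)
      - partial_deriv i f (x + s *\<^sub>R axis i 1))" by blast
  have "((\<lambda>t. partial_deriv i f (x + s *\<^sub>R axis i 1 + t *\<^sub>R axis j 1)) has_real_derivative
      partial_deriv j (partial_deriv i f) (x + s *\<^sub>R axis i 1 + t *\<^sub>R axis j 1)) (at t)" for t
    by (intro partial_deriv_line smooth_fun_partial f)
  from MVT2[OF h this] obtain t where t: "0 < t" "t < h"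
    "partial_deriv i f (x + s *\<^sub>R axis i 1 + h *\<^sub>R axis j 1)
        - partial_deriv i f (x + s *\<^sub>R axis i 1 + 0 *\<^sub>R axis j 1)
      = (h - 0) * partial_deriv j (partial_deriv i f) (x + s *\<^sub>R axis i 1 + t *\<^sub>R axis j 1)" by blast
  have "f (x + h *\<^sub>R axis i 1 + h *\<^sub>R axis j 1) - f (x + h *\<^sub>R axis i 1) - f (x + h *\<^sub>R axis j 1) + f x = ?g h - ?g 0"
    by (simp add: add_ac)
  then show ?thesis using s t by (intro exI[of _ s] exI[of _ t]) (simp add: add_ac)
qed

lemma partial_deriv_commute:
  fixes f :: "real^'n::finite \<Rightarrow> real"
  assumes f: "smooth_fun f"
  shows "partial_deriv j (partial_deriv i f) x = partial_deriv i (partial_deriv j f) x"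
proof -
  let ?a = "partial_deriv j (partial_deriv i f)" and ?b = "partial_deriv i (partial_deriv j f)"
  have "\<bar>?a x - ?b x\<bar> \<le> e" if e: "e > 0" for e
  proof -
    have near_x: "\<exists>d>0. \<forall>y. dist y x < d \<longrightarrow> dist (partial_deriv p (partial_deriv q f) y)
        (partial_deriv p (partial_deriv q f) x) < e / 2" for p q
      using smooth_fun_isCont[OF smooth_fun_partial[OF smooth_fun_partial[OF f]]] half_gt_zero[OF e]
      unfolding continuous_at_eps_delta by blast
    obtain d1 where d1: "d1 > 0" "\<And>y. dist y x < d1 \<Longrightarrow> dist (?a y) (?a x) < e / 2"
      using near_x[of j i] by blast
    obtain d2 where d2: "d2 > 0" "\<And>y. dist y x < d2 \<Longrightarrow> dist (?b y) (?b x) < e / 2"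
      using near_x[of i j] by blast
    \<comment> \<open>Half the minimum, because the two displacements add up to less than
      \<open>2 * h\<close>.\<close>
    define h where "h = min d1 d2 / 2"
    have h: "h > 0" using d1(1) d2(1) by (simp add: h_def)
    have near: "dist (x + s *\<^sub>R axis p 1 + t *\<^sub>R axis q 1) x < min d1 d2"
      if "0 < s" "s < h" "0 < t" "t < h" for s t and p q :: 'n
    proof -
      have "norm (s *\<^sub>R axis p (1::real) + t *\<^sub>R axis q 1) \<le> s + t"
        using that by (intro order_trans[OF norm_triangle_ineq]) simp
      then show ?thesis using that by (simp add: dist_norm h_def add.assoc)
    qed
    obtain s t where st: "0 < s" "s < h" "0 < t" "t < h" and
      1: "f (x + h *\<^sub>R axis i 1 + h *\<^sub>R axis j 1) - f (x + h *\<^sub>R axis i 1) - f (x + h *\<^sub>R axis j 1) + f x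
      = h * (h * ?a (x + s *\<^sub>R axis i 1 + t *\<^sub>R axis j 1))"
      using second_difference[OF f h, of x i j] by blast
    obtain s' t' where st': "0 < s'" "s' < h" "0 < t'" "t' < h" and
      2: "f (x + h *\<^sub>R axis j 1 + h *\<^sub>R axis i 1) - f (x + h *\<^sub>R axis j 1) - f (x + h *\<^sub>R axis i 1) + f x
      = h * (h * ?b (x + s' *\<^sub>R axis j 1 + t' *\<^sub>R axis i 1))"
      using second_difference[OF f h, of x j i] by blast
    have "x + h *\<^sub>R axis j 1 + h *\<^sub>R axis i 1 = x + h *\<^sub>R axis i 1 + h *\<^sub>R axis j 1"
      by (simp add: add_ac)
    then have "h * (h * ?a (x + s *\<^sub>R axis i 1 + t *\<^sub>R axis j 1))
      = h * (h * ?b (x + s' *\<^sub>R axis j 1 + t' *\<^sub>R axis i 1))"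
      using 1 2 by (simp only:)
    then have "?a (x + s *\<^sub>R axis i 1 + t *\<^sub>R axis j 1) = ?b (x + s' *\<^sub>R axis j 1 + t' *\<^sub>R axis i 1)"
      using h by simp
    moreover have "dist (?a (x + s *\<^sub>R axis i 1 + t *\<^sub>R axis j 1)) (?a x) < e / 2"
      using near[OF st, of i j] by (intro d1(2)) simp
    moreover have "dist (?b (x + s' *\<^sub>R axis j 1 + t' *\<^sub>R axis i 1)) (?b x) < e / 2"
      using near[OF st', of j i] by (intro d2(2)) simp
    ultimately show ?thesis unfolding dist_real_def by linarith
  qed
  then have "\<bar>?a x - ?b x\<bar> \<le> 0" by (rule field_le_epsilon) simp
  then show ?thesis by simp
qed

lemma transpose_hessian: "smooth_fun u \<Longrightarrow> transpose (hessian u x) = hessian u x"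
  by (simp add: vec_eq_iff transpose_def hessian_def partial_deriv_commute)

text \<open>The right-hand side of the equation is \<open>euler 1 u\<close>; partial derivatives only lower \<open>c\<close>, and
  at \<open>c = 0\<close> just the radial derivative is left.\<close>

definition euler :: "real \<Rightarrow> (real^'n::finite \<Rightarrow> real) \<Rightarrow> real^'n \<Rightarrow> real" where
  "euler c w x = (1 / 2) * (\<Sum>i\<in>UNIV. x $ i * partial_deriv i w x) - c * w x"

lemma has_derivative_euler:
  assumes w: "smooth_fun w"
  shows "(euler c w has_derivative
    (\<lambda>v. (1 / 2) * (\<Sum>i\<in>UNIV. x $ i * (\<Sum>j\<in>UNIV. v $ j * partial_deriv j (partial_deriv i w) x)
        + v $ i * partial_deriv i w x) - c * (\<Sum>j\<in>UNIV. v $ j * partial_deriv j w x))) (at x)"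
  unfolding euler_def
  by (intro has_derivative_diff has_derivative_mult_right has_derivative_sum has_derivative_mult
      has_derivative_partial smooth_fun_differentiable smooth_fun_partial w
      bounded_linear.has_derivative[OF bounded_linear_vec_nth] has_derivative_ident)

lemma euler_differentiable: "smooth_fun w \<Longrightarrow> euler c w differentiable (at x)"
  using has_derivative_euler differentiable_def by blast

lemma sum_axis: "(\<Sum>j\<in>UNIV. axis l 1 $ j * (f j :: real)) = f l"
  by (simp add: axis_def if_distrib if_distribR cong: if_cong)

text \<open>The derivative falling on the coordinate \<open>x $ l\<close> supplies an extra half of
  \<open>partial_deriv l w\<close>; two derivatives thus take the weight 1 down to 0.\<close>

lemma partial_deriv_euler:
  assumes w: "smooth_fun w"
  shows "partial_deriv l (euler c w) = euler (c - 1 / 2) (partial_deriv l w)"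
proof
  fix x
  have "partial_deriv l (euler c w) x = (1 / 2) * (\<Sum>i\<in>UNIV. x $ i * partial_deriv l (partial_deriv i w) x
        + axis l 1 $ i * partial_deriv i w x) - c * partial_deriv l w x"
    using partial_deriv_eqI[OF has_derivative_euler[OF w], of l c x] by (simp only: sum_axis)
  also have "\<dots> = euler (c - 1 / 2) (partial_deriv l w) x"
    by (simp add: sum.distrib sum_axis sum_axis[unfolded mult.commute[of "axis _ _ $ _"]] euler_def partial_deriv_commute[OF w, of l] algebra_simps)
  finally show "partial_deriv l (euler c w) x = euler (c - 1 / 2) (partial_deriv l w) x" .
qed

section \<open>Second-order conditions and orthonormal coordinates\<close>

lemma second_derivative_test:
  fixes g g' :: "real \<Rightarrow> real"
  assumes g: "\<And>t. (g has_real_derivative g' t) (at t)" and g': "(g' has_real_derivative d) (at 0)"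
    and e: "e > 0" and max: "\<And>t. \<bar>t\<bar> < e \<Longrightarrow> g t \<le> g 0"
  shows "g' 0 = 0 \<and> d \<le> 0"
proof -
  have 0: "g' 0 = 0"
    by (rule DERIV_local_max[OF g e]) (simp add: max)
  have "d \<le> 0"
  proof (rule ccontr)
    assume "\<not> d \<le> 0"
    then obtain r where r: "r > 0" "\<And>h. 0 < h \<Longrightarrow> h < r \<Longrightarrow> g' 0 < g' (0 + h)"
      using DERIV_pos_inc_right[OF g'] by (auto simp: not_le)
    define h where "h = min e r / 2"
    have h: "0 < h" "h < e" "h < r" using e r by (auto simp: h_def)
    from MVT2[OF h(1) g] obtain s where s: "0 < s" "s < h" "g h - g 0 = (h - 0) * g' s" by blast
    have "h * g' s > 0" using s h r(2)[of s] 0 by simp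
    then show False using s max[of h] h by simp
  qed
  with 0 show ?thesis by simp
qed

text \<open>Serves to turn a lower bound on the coefficients in an unknown eigenbasis into one by
  the squared length, whatever that basis is.\<close>

lemma orthonormal_parseval:
  fixes q :: "'n::finite \<Rightarrow> real^'n"
  assumes "orthonormal q"
  shows "(\<Sum>i\<in>UNIV. (x \<bullet> q i)\<^sup>2) = x \<bullet> x"
proof -
  define Q :: "real^'n^'n" where "Q = (\<chi> i j. q j $ i)"
  have "transpose Q ** Q = mat 1"
    using assms by (simp add: orthonormal_def vec_eq_iff matrix_matrix_mult_def transpose_def Q_def
        inner_vec_def mat_def)
  then have "Q ** transpose Q = mat 1" by (simp add: matrix_left_right_inverse)
  then have "Q *v (transpose Q *v x) = x" by (metis matrix_vector_mul_assoc matrix_vector_mul_lid)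
  then have "x \<bullet> x = x \<bullet> (Q *v (transpose Q *v x))" by simp
  also have "\<dots> = (transpose Q *v x) \<bullet> (transpose Q *v x)"
    by (simp add: dot_lmul_matrix[symmetric] transpose_matrix_vector)
  also have "\<dots> = (\<Sum>i\<in>UNIV. (x \<bullet> q i)\<^sup>2)"
    by (simp add: inner_vec_def matrix_vector_mult_def transpose_def Q_def power2_eq_square mult.commute)
  finally show ?thesis ..
qed

lemma orthonormal_norm: "orthonormal q \<Longrightarrow> q i \<bullet> q i = 1"
  by (simp add: orthonormal_def)

subsection \<open>Maximum principle\<close>

text \<open>With \<open>k = Suc m\<close> the index \<open>k - 1\<close> is simply \<open>m\<close>.
  Degree 0 is included in \<open>pos\<close> so that the lemmas on symmetric functions apply
  directly.\<close>

locale shrinker =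
  fixes u :: "real^'n::finite \<Rightarrow> real" and m :: nat
  assumes smooth: "smooth_fun u" and m: "Suc m \<le> CARD('n)"
    and pos: "\<And>j x. j \<le> Suc m \<Longrightarrow> esym j UNIV (($) (eigenvals (hessian u x))) > 0"
    and eq: "\<And>x. - (esym m UNIV (($) (eigenvals (hessian u x)))
        / esym (Suc m) UNIV (($) (eigenvals (hessian u x)))) = (1 / 2) * (x \<bullet> gradient u x) - u x"
begin

abbreviation "lam x \<equiv> ($) (eigenvals (hessian u x))"

abbreviation "phi \<equiv> euler 1 u"

text \<open>The diagonal entries of the linearised operator in an eigenbasis of the Hessian; the
  squared denominator is that of the quotient rule.\<close>

definition "coef i x = ellip m UNIV i (lam x) / (esym (Suc m) UNIV (lam x))\<^sup>2"

lemma phi_eq: "phi x = - (esym m UNIV (lam x) / esym (Suc m) UNIV (lam x))"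
  by (simp add: eq euler_def inner_vec_def gradient_def)

lemma phi_neg: "phi x < 0"
  using pos[of m x] pos[of "Suc m" x] by (simp add: phi_eq)

lemma coef_pos: "coef i x > 0"
  unfolding coef_def using pos[of "Suc m" x]
  by (intro divide_pos_pos ellip_pos pos) auto

lemma sum_coef_le: "(\<Sum>i\<in>UNIV. coef i x) \<le> CARD('n) * (phi x)\<^sup>2"
proof -
  have "(\<Sum>i\<in>UNIV. coef i x) = (\<Sum>i\<in>UNIV. ellip m UNIV i (lam x)) / (esym (Suc m) UNIV (lam x))\<^sup>2"
    by (simp add: coef_def sum_divide_distrib)
  also have "\<dots> \<le> (CARD('n) * (esym m UNIV (lam x))\<^sup>2) / (esym (Suc m) UNIV (lam x))\<^sup>2"
    by (intro divide_right_mono sum_ellip_le pos) auto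
  finally show ?thesis by (simp add: phi_eq power_divide)
qed

lemma differentiable_phi: "phi differentiable (at x)"
  by (rule euler_differentiable[OF smooth])

lemma differentiable_partial_phi: "partial_deriv i phi differentiable (at x)"
  by (simp add: partial_deriv_euler smooth euler_differentiable smooth_fun_partial)

lemma continuous_on_phi: "continuous_on S phi"
  by (intro continuous_at_imp_continuous_on ballI differentiable_imp_continuous_within
      differentiable_phi)

lemma csym_hessian: "k \<le> CARD('n) \<Longrightarrow> csym k (hessian u x) = esym k UNIV (lam x)"
  using ex_eigenvals_basis[OF transpose_hessian[OF smooth, of x]] csym_eigenbasis by blast

text \<open>Two derivatives bring the weight of \<open>phi\<close> to 0, so
  \<open>hessian phi\<close> is half the radial derivative of \<open>hessian u\<close>.\<close>

lemma hessian_radial_deriv: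
  "((\<lambda>t. hessian u (p + t *\<^sub>R p) $ i $ j) has_real_derivative (2 *\<^sub>R hessian phi p) $ i $ j) (at 0)"
proof -
  have "((\<lambda>t. hessian u (p + t *\<^sub>R p) $ i $ j) has_real_derivative
     (\<Sum>r\<in>UNIV. p $ r * partial_deriv r (partial_deriv j (partial_deriv i u)) (p + 0 *\<^sub>R p))) (at 0)"
    unfolding hessian_def vec_lambda_beta
    by (intro line_deriv smooth_fun_differentiable smooth_fun_partial smooth)
  moreover have "hessian phi p $ i $ j = euler 0 (partial_deriv j (partial_deriv i u)) p"
    by (simp add: hessian_def partial_deriv_euler smooth smooth_fun_partial)
  then have "(2 *\<^sub>R hessian phi p) $ i $ j
      = (\<Sum>r\<in>UNIV. p $ r * partial_deriv r (partial_deriv j (partial_deriv i u)) p)"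
    by (simp add: euler_def)
  ultimately show ?thesis by simp
qed

text \<open>The equation differentiated in the radial direction: the drift term on the left is twice the
  linearised operator applied to the Hessian of \<open>phi\<close>.\<close>

lemma linearized_equation:
  "\<exists>q. orthonormal q \<and> (\<Sum>i\<in>UNIV. p $ i * partial_deriv i phi p)
     = 2 * (\<Sum>i\<in>UNIV. coef i p * (q i \<bullet> (hessian phi p *v q i)))"
proof -
  obtain q where q: "orthonormal q" "\<And>i. hessian u p *v q i = lam p i *\<^sub>R q i"
    using ex_eigenvals_basis[OF transpose_hessian[OF smooth]] by blast
  let ?l = "lam p"
  let ?B = "\<lambda>i. q i \<bullet> ((2 *\<^sub>R hessian phi p) *v q i)"
  have d: "((\<lambda>t. csym k (hessian u (p + t *\<^sub>R p))) has_real_derivative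
      (\<Sum>i\<in>UNIV. ?B i * esym_partial k UNIV i ?l)) (at 0)" if "k \<le> CARD('n)" for k
    using q that by (intro csym_deriv hessian_radial_deriv) auto
  let ?a = "esym m UNIV ?l" and ?b = "esym (Suc m) UNIV ?l"
  let ?a' = "\<Sum>i\<in>UNIV. ?B i * esym_partial m UNIV i ?l"
  let ?b' = "\<Sum>i\<in>UNIV. ?B i * esym_partial (Suc m) UNIV i ?l"
  have "((\<lambda>t. - (csym m (hessian u (p + t *\<^sub>R p)) / csym (Suc m) (hessian u (p + t *\<^sub>R p))))
      has_real_derivative - ((?a' * ?b - ?a * ?b') / (?b * ?b))) (at 0)"
    using DERIV_minus[OF DERIV_divide[OF d d]] m pos[of "Suc m" p] by (simp add: csym_hessian)
  \<comment> \<open>The equation holds along the whole ray, so the quotient of \<open>csym\<close>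
    terms and \<open>phi\<close> are the same function of \<open>t\<close>; computing its derivative
    in both ways gives the claim.\<close>
  moreover have "(\<lambda>t. - (csym m (hessian u (p + t *\<^sub>R p)) / csym (Suc m) (hessian u (p + t *\<^sub>R p))))
      = (\<lambda>t. phi (p + t *\<^sub>R p))"
    using m by (simp add: phi_eq csym_hessian)
  ultimately have "((\<lambda>t. phi (p + t *\<^sub>R p)) has_real_derivative - ((?a' * ?b - ?a * ?b') / (?b * ?b))) (at 0)"
    by simp
  moreover have "((\<lambda>t. phi (p + t *\<^sub>R p)) has_real_derivative
      (\<Sum>i\<in>UNIV. p $ i * partial_deriv i phi (p + 0 *\<^sub>R p))) (at 0)"
    by (intro line_deriv differentiable_phi)
  ultimately have "(\<Sum>i\<in>UNIV. p $ i * partial_deriv i phi p) = - ((?a' * ?b - ?a * ?b') / (?b * ?b))"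
    using DERIV_unique by fastforce
  also have "\<dots> = (\<Sum>i\<in>UNIV. ?B i * ellip m UNIV i ?l) / ?b\<^sup>2"
  proof -
    have "?a * ?b' - ?a' * ?b = (\<Sum>i\<in>UNIV. ?B i * ellip m UNIV i ?l)"
      by (simp add: ellip_def sum_distrib_left sum_distrib_right sum_subtractf right_diff_distrib mult_ac)
    then show ?thesis by (simp only: minus_divide_left minus_diff_eq power2_eq_square)
  qed
  also have "\<dots> = 2 * (\<Sum>i\<in>UNIV. coef i p * (q i \<bullet> (hessian phi p *v q i)))"
    by (simp add: coef_def sum_distrib_left sum_divide_distrib mult_ac flip: scaleR_matrix_vector_assoc)
  finally show ?thesis using q(1) by blast
qed

text \<open>Where \<open>w\<close> touches \<open>phi\<close> from above up to a constant, first
  derivatives agree and second derivatives are ordered; positivity of \<open>coef\<close> carries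
  this into the linearised equation. Only restrictions of \<open>w\<close> to lines through
  \<open>p\<close> enter, so each application needs one-variable calculus only.\<close>

lemma touching_test:
  assumes r: "r > 0" and max: "\<And>x. dist x p < r \<Longrightarrow> phi x - w x \<le> phi p - w p"
    and w1: "\<And>v t. ((\<lambda>t. w (p + t *\<^sub>R v)) has_real_derivative w1 v t) (at t)"
    and w2: "\<And>v. (w1 v has_real_derivative w2 v) (at 0)"
  shows "\<exists>q. orthonormal q \<and> w1 p 0 \<le> 2 * (\<Sum>i\<in>UNIV. coef i p * w2 (q i))"
proof -
  have test: "(\<Sum>i\<in>UNIV. v $ i * partial_deriv i phi p) = w1 v 0 \<and> v \<bullet> (hessian phi p *v v) \<le> w2 v" for v
  proof -
    let ?g = "\<lambda>t. phi (p + t *\<^sub>R v) - w (p + t *\<^sub>R v)"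
    let ?g' = "\<lambda>t. (\<Sum>i\<in>UNIV. v $ i * partial_deriv i phi (p + t *\<^sub>R v)) - w1 v t"
    have "(?g has_real_derivative ?g' t) (at t)" for t
      by (intro DERIV_diff line_deriv w1 differentiable_phi)
    moreover have "(?g' has_real_derivative (\<Sum>i\<in>UNIV. v $ i *
        (\<Sum>j\<in>UNIV. v $ j * partial_deriv j (partial_deriv i phi) (p + 0 *\<^sub>R v))) - w2 v) (at 0)"
      by (intro DERIV_diff DERIV_sum DERIV_cmult line_deriv w2 differentiable_partial_phi)
    \<comment> \<open>Adding 1 to the norm keeps the radius meaningful for
      \<open>v = 0\<close>.\<close>
    moreover have "?g t \<le> ?g 0" if "\<bar>t\<bar> < r / (norm v + 1)" for t
    proof -
      have "norm v + 1 > 0" by (simp add: add_nonneg_pos)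
      then have "\<bar>t\<bar> * (norm v + 1) < r" using that by (simp only: pos_less_divide_eq)
      moreover have "\<bar>t\<bar> * norm v \<le> \<bar>t\<bar> * (norm v + 1)" by (simp add: mult_left_mono)
      ultimately show ?thesis using max[of "p + t *\<^sub>R v"] by (simp add: dist_norm)
    qed
    moreover have "r / (norm v + 1) > 0" using r by (simp add: add_nonneg_pos)
    ultimately have "?g' 0 = 0 \<and> (\<Sum>i\<in>UNIV. v $ i *
        (\<Sum>j\<in>UNIV. v $ j * partial_deriv j (partial_deriv i phi) (p + 0 *\<^sub>R v))) - w2 v \<le> 0"
      by (intro second_derivative_test[of ?g ?g']) auto
    then show ?thesis
      by (simp add: inner_vec_def matrix_vector_mult_def hessian_def mult.commute)
  qed
  obtain q where q: "orthonormal q" "(\<Sum>i\<in>UNIV. p $ i * partial_deriv i phi p)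
     = 2 * (\<Sum>i\<in>UNIV. coef i p * (q i \<bullet> (hessian phi p *v q i)))"
    using linearized_equation by blast
  have "(\<Sum>i\<in>UNIV. coef i p * (q i \<bullet> (hessian phi p *v q i))) \<le> (\<Sum>i\<in>UNIV. coef i p * w2 (q i))"
    using test coef_pos by (intro sum_mono mult_left_mono) (auto intro: less_imp_le)
  then show ?thesis using q test[of p] by auto
qed

end

section \<open>Existence of a maximum point of \<open>phi\<close>\<close>

context shrinker
begin

text \<open>The drift of the penalty at \<open>p\<close> is \<open>2 * e * (p \<bullet> p)\<close>
  and its second derivative along unit vectors is \<open>2 * e\<close>, so \<open>e\<close> cancels
  from the touching test.\<close>

lemma max_of_penalized:
  assumes e: "e > 0" and max: "\<And>x. phi x - e * (x \<bullet> x) \<le> phi p - e * (p \<bullet> p)"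
  shows "p \<bullet> p \<le> 2 * CARD('n) * (phi 0)\<^sup>2"
proof -
  let ?w = "\<lambda>x. e * (x \<bullet> x)"
  let ?w1 = "\<lambda>v t. e * (2 * (v \<bullet> (p + t *\<^sub>R v)))"
  let ?w2 = "\<lambda>v. e * (2 * (v \<bullet> v))"
  have "\<exists>q. orthonormal q \<and> ?w1 p 0 \<le> 2 * (\<Sum>i\<in>UNIV. coef i p * ?w2 (q i))"
  proof (rule touching_test[where r = 1 and w = ?w and p = p and ?w1.0 = ?w1 and ?w2.0 = ?w2])
    show "((\<lambda>t. ?w (p + t *\<^sub>R v)) has_real_derivative ?w1 v t) (at t)" for v t
      unfolding inner_add_left inner_add_right inner_scaleR_left inner_scaleR_right
      by (auto intro!: derivative_eq_intros simp: algebra_simps inner_commute)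
    show "(?w1 v has_real_derivative ?w2 v) (at 0)" for v
      unfolding inner_add_right inner_scaleR_right
      by (auto intro!: derivative_eq_intros)
  qed (use max in auto)
  then obtain q where q: "orthonormal q" "?w1 p 0 \<le> 2 * (\<Sum>i\<in>UNIV. coef i p * ?w2 (q i))" by blast
  have "2 * (\<Sum>i\<in>UNIV. coef i p * ?w2 (q i)) = (2 * e) * (2 * (\<Sum>i\<in>UNIV. coef i p))"
    using q(1) by (simp add: orthonormal_norm sum_distrib_left mult_ac)
  with q(2) have "(2 * e) * (p \<bullet> p) \<le> (2 * e) * (2 * (\<Sum>i\<in>UNIV. coef i p))" by simp
  then have "p \<bullet> p \<le> 2 * (\<Sum>i\<in>UNIV. coef i p)" using e by simp
  also have "\<dots> \<le> 2 * (CARD('n) * (phi p)\<^sup>2)" using sum_coef_le by simp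
  also have "(phi p)\<^sup>2 \<le> (phi 0)\<^sup>2"
  proof -
    have "0 \<le> e * (p \<bullet> p)" using e by simp
    then have "phi 0 \<le> phi p" using max[of 0] by simp
    then show ?thesis using phi_neg[of p] abs_le_square_iff[of "phi p" "phi 0"] phi_neg[of 0] by simp
  qed
  finally show ?thesis by simp
qed

text \<open>All penalised maxima lie in one fixed ball, so the maximum of \<open>phi\<close> over
  that ball bounds \<open>phi\<close> everywhere once the penalty is sent to zero.\<close>

lemma phi_attains_max: "\<exists>p. \<forall>x. phi x \<le> phi p"
proof -
  define R where "R = 2 * CARD('n) * (phi 0)\<^sup>2"
  have R0: "R \<ge> 0" by (simp add: R_def)
  let ?B = "cball (0 :: real^'n) (sqrt R)"
  have inB: "x \<in> ?B" if "x \<bullet> x \<le> R" for x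
    using that by (simp add: norm_eq_sqrt_inner)
  have "0 \<in> ?B" using R0 by simp
  then obtain p where p: "\<And>x. x \<in> ?B \<Longrightarrow> phi x \<le> phi p"
    using continuous_attains_sup[of ?B phi] continuous_on_phi by fastforce
  have "phi x \<le> phi p + d" if d: "d > 0" for x d
  proof -
    \<comment> \<open>With this \<open>e\<close> the penalty at the given point \<open>x\<close>
      costs at most \<open>d\<close>.\<close>
    define e where "e = d / (x \<bullet> x + 1)"
    have "x \<bullet> x + 1 > 0" by (simp add: add_nonneg_pos)
    then have e: "e > 0" "e * (x \<bullet> x + 1) = d" using d by (auto simp: e_def)
    let ?f = "\<lambda>x. phi x - e * (x \<bullet> x)"
    \<comment> \<open>Outside \<open>?C\<close> the penalty exceeds \<open>- phi 0\<close>; as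
      \<open>phi\<close> is negative, the penalised function is then below its value at 0.\<close>
    let ?C = "cball (0 :: real^'n) (sqrt (- phi 0 / e))"
    have "0 \<in> ?C" using phi_neg[of 0] e by (simp add: divide_nonpos_pos)
    moreover have "continuous_on ?C ?f" by (intro continuous_intros continuous_on_phi)
    ultimately obtain b where b: "\<And>y. y \<in> ?C \<Longrightarrow> ?f y \<le> ?f b"
      using continuous_attains_sup[of ?C ?f] by fastforce
    have "?f y \<le> ?f b" for y
    proof (cases "y \<in> ?C")
      case False
      then have "y \<bullet> y > - phi 0 / e" by (simp add: norm_eq_sqrt_inner)
      then have "e * (y \<bullet> y) > - phi 0" using e(1) by (simp only: pos_divide_less_eq mult.commute)
      then have "?f y < ?f 0" using phi_neg[of y] by simp
      also have "?f 0 \<le> ?f b" using \<open>0 \<in> ?C\<close> by (rule b)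
      finally show ?thesis by simp
    qed (rule b)
    then have "phi b \<le> phi p"
      using max_of_penalized[OF e(1), of b] unfolding R_def[symmetric] by (intro p inB) auto
    moreover have "0 \<le> e * (b \<bullet> b)" using e by simp
    ultimately have "phi x \<le> phi p + e * (x \<bullet> x)" using \<open>\<And>y. ?f y \<le> ?f b\<close>[of x] by linarith
    then show ?thesis using e by (simp add: distrib_left)
  qed
  then have "phi x \<le> phi p" for x by (rule field_le_epsilon)
  then show ?thesis by blast
qed

section \<open>Strong maximum principle\<close>

lemma eigenvals_bound: "\<bar>lam x i\<bar> \<le> (\<Sum>i\<in>UNIV. \<Sum>j\<in>UNIV. \<bar>hessian u x $ i $ j\<bar>)"
proof -
  obtain q where q: "orthonormal q" "\<And>i. hessian u x *v q i = lam x i *\<^sub>R q i"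
    using ex_eigenvals_basis[OF transpose_hessian[OF smooth]] by blast
  have n: "norm (q i) = 1" using orthonormal_norm[OF q(1)] by (simp add: norm_eq_1)
  have "\<bar>lam x i\<bar> = norm (hessian u x *v q i)" by (simp add: q(2) n)
  also have "\<dots> \<le> onorm ((*v) (hessian u x)) * norm (q i)"
    by (intro onorm matrix_vector_mul_bounded_linear)
  also have "\<dots> \<le> (\<Sum>i\<in>UNIV. \<Sum>j\<in>UNIV. \<bar>hessian u x $ i $ j\<bar>)"
    using onorm_le_matrix_component_sum[of "hessian u x"] by (simp add: n)
  finally show ?thesis .
qed

lemma continuous_on_hessian: "continuous_on S (\<lambda>x. hessian u x $ i $ j)"
  unfolding hessian_def vec_lambda_beta
  by (intro continuous_at_imp_continuous_on ballI smooth_fun_isCont smooth_fun_partial smooth)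

text \<open>Continuity of \<open>coef\<close> in \<open>x\<close> is bypassed. The eigenvalue
  vectors over \<open>X\<close> stay in a compact set on which the formula defining
  \<open>coef\<close> is continuous and positive as a function of the eigenvalues.\<close>

lemma uniform_ellipticity:
  assumes X: "compact X"
  shows "\<exists>c>0. \<forall>x\<in>X. \<forall>i. c \<le> coef i x"
proof (cases "X = {}")
  case False
  have "\<exists>e>0. \<forall>x\<in>X. e \<le> esym j UNIV (lam x)" if j: "j \<le> Suc m" for j
  proof -
    have "continuous_on X (\<lambda>x. csym j (hessian u x))"
      by (intro continuous_on_csym continuous_on_hessian)
    then have "continuous_on X (\<lambda>x. esym j UNIV (lam x))" using j m by (simp add: csym_hessian)
    from continuous_attains_inf[OF X False this] show ?thesis using pos[OF j] by meson
  qed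
  then obtain e where e: "\<And>j. j \<le> Suc m \<Longrightarrow> e j > 0"
    "\<And>j x. j \<le> Suc m \<Longrightarrow> x \<in> X \<Longrightarrow> e j \<le> esym j UNIV (lam x)" by metis
  have "continuous_on X (\<lambda>x. \<Sum>i\<in>UNIV. \<Sum>j\<in>UNIV. \<bar>hessian u x $ i $ j\<bar>)"
    by (intro continuous_intros continuous_on_hessian)
  from continuous_attains_sup[OF X False this] obtain b where
    b: "\<And>x i. x \<in> X \<Longrightarrow> \<bar>lam x i\<bar> \<le> b" using eigenvals_bound order_trans by meson
  \<comment> \<open>The lower bounds \<open>e j\<close> are attained minima over \<open>X\<close>;
    they keep \<open>K\<close> closed and inside the positivity cone, while \<open>b\<close> keeps
    it bounded.\<close>
  define K where "K = cbox (\<chi> i. - b) (\<chi> i. b) \<inter> (\<Inter>j\<in>{..Suc m}. {l :: real^'n. e j \<le> esym j UNIV (($) l)})"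
  have K: "compact K" unfolding K_def
    by (intro compact_Int_closed closed_INT ballI closed_Collect_le continuous_on_esym continuous_on_const) auto
  have XK: "eigenvals (hessian u x) \<in> K" if "x \<in> X" for x
    unfolding K_def using e(2) that b[OF that] by (auto simp: mem_box_cart abs_le_iff) (metis minus_le_iff)
  then have K0: "K \<noteq> {}" using False by blast
  have posK: "esym j UNIV (($) l) > 0" if "l \<in> K" "j \<le> Suc m" for l j
    using that e(1)[of j] unfolding K_def by force
  have "\<exists>c>0. \<forall>l\<in>K. c \<le> ellip m UNIV i (($) l) / (esym (Suc m) UNIV (($) l))\<^sup>2" for i
  proof -
    have "continuous_on K (\<lambda>l. ellip m UNIV i (($) l) / (esym (Suc m) UNIV (($) l))\<^sup>2)"
      using posK[of _ "Suc m"]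
      by (intro continuous_intros continuous_on_ellip continuous_on_esym) force
    from continuous_attains_inf[OF K K0 this] obtain l where l: "l \<in> K"
      "\<forall>y\<in>K. ellip m UNIV i (($) l) / (esym (Suc m) UNIV (($) l))\<^sup>2
        \<le> ellip m UNIV i (($) y) / (esym (Suc m) UNIV (($) y))\<^sup>2" by blast
    have "ellip m UNIV i (($) l) > 0" using l(1) posK by (intro ellip_pos) auto
    moreover have "esym (Suc m) UNIV (($) l) > 0" using l(1) posK by blast
    ultimately have "ellip m UNIV i (($) l) / (esym (Suc m) UNIV (($) l))\<^sup>2 > 0" by simp
    then show ?thesis using l(2) by blast
  qed
  then obtain c where c: "\<And>i. c i > 0"
    "\<And>i l. l \<in> K \<Longrightarrow> c i \<le> ellip m UNIV i (($) l) / (esym (Suc m) UNIV (($) l))\<^sup>2" by metis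
  have "Min (range c) > 0" using c by simp
  moreover have "Min (range c) \<le> coef i x" if "x \<in> X" for x i
    using c(2)[OF XK[OF that], of i] by (intro order_trans[OF Min_le]) (auto simp: coef_def)
  ultimately show ?thesis by blast
qed (auto intro: exI[of _ 1])

text \<open>Hopf's barrier argument: at a maximum on the boundary of a ball free of other maxima,
  adding a small multiple of \<open>exp (- a * norm (x - y)\<^sup>2)\<close> creates an interior maximum at a point where
  the barrier is a strict subsolution.\<close>

lemma no_touching_ball:
  assumes max: "\<And>x. phi x \<le> M" and z: "phi z = M" "z \<noteq> y"
    and less: "\<And>x. dist x y \<le> dist z y \<Longrightarrow> x \<noteq> z \<Longrightarrow> phi x < M"
  shows False
proof -
  define r where "r = dist z y"
  have r: "r > 0" using z by (simp add: r_def)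
  \<comment> \<open>Radius \<open>r / 2\<close> keeps \<open>?X\<close> at distance at least
    \<open>r / 2\<close> from the centre \<open>y\<close>, where the gradient of the barrier
    vanishes.\<close>
  let ?X = "cball z (r / 2)"
  obtain c where c: "c > 0" "\<And>x i. x \<in> ?X \<Longrightarrow> c \<le> coef i x"
    using uniform_ellipticity[of ?X] by auto
  \<comment> \<open>This is the trace bound minus the drift: all that the second-order term of the
    barrier has to beat.\<close>
  have "continuous_on ?X (\<lambda>x. 2 * (CARD('n) * (phi x)\<^sup>2) - (x - y) \<bullet> x)"
    by (intro continuous_intros continuous_on_phi)
  then obtain b where b: "\<And>x. x \<in> ?X \<Longrightarrow> 2 * (CARD('n) * (phi x)\<^sup>2) - (x - y) \<bullet> x \<le> b"
    using continuous_attains_sup[of ?X "\<lambda>x. 2 * (CARD('n) * (phi x)\<^sup>2) - (x - y) \<bullet> x"] r by fastforce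
  \<comment> \<open>The barrier contributes \<open>4 * a * c\<close> times a squared distance of at
    least \<open>r^2 / 4\<close>, that is at least
    \<open>a * c * r^2 = \<bar>b\<bar> + 1 > b\<close>.\<close>
  define a where "a = (\<bar>b\<bar> + 1) / (c * r\<^sup>2)"
  have a: "a > 0" "a * (c * r\<^sup>2) > b" using c r by (auto simp: a_def)
  define h where "h = (\<lambda>x. exp (- a * ((x - y) \<bullet> (x - y))))"
  have h_pos: "h x > 0" for x by (simp add: h_def)
  have h_le: "h x \<le> 1" for x using a by (simp add: h_def)
  have h_less: "h x < h z" if "dist x y > r" for x
  proof -
    have "r\<^sup>2 < (dist x y)\<^sup>2" using that r by (intro power_strict_mono) auto
    then show ?thesis using a by (simp add: h_def r_def dist_norm power2_norm_eq_inner)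
  qed
  have cont_h: "continuous_on S h" for S unfolding h_def by (intro continuous_intros)
  \<comment> \<open>The part of the small sphere inside the touching ball avoids \<open>z\<close>,
    so by compactness \<open>phi\<close> has a gap below \<open>M\<close> there, and
    \<open>d\<close> stays within it. On the rest of the sphere \<open>h\<close> is smaller than at
    \<open>z\<close>. Hence a maximum of \<open>phi + d * h\<close> over \<open>?X\<close> cannot
    lie on the sphere.\<close>
  obtain d where d: "d > 0" "\<And>x. dist z x = r / 2 \<Longrightarrow> dist x y \<le> r \<Longrightarrow> phi x + d < M"
  proof (cases "sphere z (r / 2) \<inter> cball y r = {}")
    case True
    have "\<not> dist x y \<le> r" if "dist z x = r / 2" for x
    proof
      assume "dist x y \<le> r"
      then have "x \<in> sphere z (r / 2) \<inter> cball y r" using that by (simp add: dist_commute)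
      with True show False by blast
    qed
    then show ?thesis by (intro that[of 1]) auto
  next
    case False
    have "compact (sphere z (r / 2) \<inter> cball y r)" by (intro compact_Int_closed) auto
    from continuous_attains_sup[OF this False continuous_on_phi] obtain x0 where
      x0: "x0 \<in> sphere z (r / 2) \<inter> cball y r" "\<And>x. x \<in> sphere z (r / 2) \<inter> cball y r \<Longrightarrow> phi x \<le> phi x0"
      by blast
    have "x0 \<noteq> z" using x0 r by auto
    then have lt: "phi x0 < M" using x0 by (intro less) (auto simp: r_def dist_commute)
    have "phi x + (M - phi x0) / 2 < M" if "dist z x = r / 2" "dist x y \<le> r" for x
    proof -
      have "phi x \<le> phi x0" using that by (intro x0(2)) (simp add: dist_commute)
      then show ?thesis using lt by (simp add: field_simps)
    qed
    then show ?thesis using lt by (intro that[of "(M - phi x0) / 2"]) auto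
  qed
  let ?f = "\<lambda>x. phi x + d * h x"
  have "continuous_on ?X ?f" by (intro continuous_intros continuous_on_phi cont_h)
  then obtain p where p: "p \<in> ?X" "\<And>x. x \<in> ?X \<Longrightarrow> ?f x \<le> ?f p"
    using continuous_attains_sup[of ?X ?f] r by fastforce
  have "dist z p \<noteq> r / 2"
  proof
    assume eq: "dist z p = r / 2"
    have "?f p < ?f z"
    proof (cases "dist p y \<le> r")
      case True
      then have "phi p + d < M" using d eq by blast
      moreover have "d * h p \<le> d" using d h_le[of p] by simp
      moreover have "0 < d * h z" using d h_pos by simp
      ultimately show ?thesis using z(1) by linarith
    next
      case False
      then have "d * h p < d * h z" using h_less d by simp
      then show ?thesis using max[of p] z(1) by linarith
    qed
    moreover have "z \<in> ?X" using r by simp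
    ultimately show False using p(2) by fastforce
  qed
  then have pz: "dist z p < r / 2" using p(1) by simp
  let ?k = "\<lambda>v t. (p + t *\<^sub>R v - y) \<bullet> v"
  let ?w1 = "\<lambda>v t. 2 * a * d * (?k v t * h (p + t *\<^sub>R v))"
  let ?w2 = "\<lambda>v. 2 * a * d * (h p * (v \<bullet> v - 2 * a * ((p - y) \<bullet> v)\<^sup>2))"
  have dk: "(?k v has_real_derivative v \<bullet> v) (at t)" for v t
    unfolding inner_add_left inner_diff_left inner_scaleR_left
    by (auto intro!: derivative_eq_intros)
  have dh: "((\<lambda>t. h (p + t *\<^sub>R v)) has_real_derivative - 2 * a * (?k v t * h (p + t *\<^sub>R v))) (at t)" for v t
  proof -
    have "((\<lambda>t. (p + t *\<^sub>R v - y) \<bullet> (p + t *\<^sub>R v - y)) has_real_derivative 2 * ?k v t) (at t)"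
      unfolding inner_add_left inner_diff_left inner_scaleR_left inner_add_right inner_diff_right inner_scaleR_right
      by (auto intro!: derivative_eq_intros simp: algebra_simps inner_commute)
    from DERIV_fun_exp[OF DERIV_cmult[OF this, of "- a"]] show ?thesis
      by (simp add: h_def mult_ac)
  qed
  have "\<exists>q. orthonormal q \<and> ?w1 p 0 \<le> 2 * (\<Sum>i\<in>UNIV. coef i p * ?w2 (q i))"
  proof (rule touching_test[where w = "\<lambda>x. - d * h x" and r = "r / 2 - dist z p" and p = p
        and ?w1.0 = ?w1 and ?w2.0 = ?w2])
    show "r / 2 - dist z p > 0" using pz by simp
    show "phi x - - d * h x \<le> phi p - - d * h p" if "dist x p < r / 2 - dist z p" for x
      using p(2)[of x] dist_triangle[of z x p] that by (simp add: dist_commute)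
    show "((\<lambda>t. - d * h (p + t *\<^sub>R v)) has_real_derivative ?w1 v t) (at t)" for v t
      using DERIV_cmult[OF dh, of "- d"] by (simp add: mult_ac)
    show "(?w1 v has_real_derivative ?w2 v) (at 0)" for v
      by (rule DERIV_cong[OF DERIV_cmult[OF DERIV_mult[OF dk dh]]])
        (simp add: algebra_simps power2_eq_square)
  qed
  then obtain q where q: "orthonormal q" "?w1 p 0 \<le> 2 * (\<Sum>i\<in>UNIV. coef i p * ?w2 (q i))" by blast
  define A where "A = 2 * a * d * h p"
  have A: "A > 0" using a d h_pos by (simp add: A_def)
  have lhs: "?w1 p 0 = A * ((p - y) \<bullet> p)" by (simp add: A_def mult_ac)
  have rhs: "2 * (\<Sum>i\<in>UNIV. coef i p * ?w2 (q i))
      = A * (2 * (\<Sum>i\<in>UNIV. coef i p) - 4 * a * (\<Sum>i\<in>UNIV. coef i p * ((p - y) \<bullet> q i)\<^sup>2))"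
    using orthonormal_norm[OF q(1)]
    by (simp add: A_def sum_distrib_left sum_subtractf right_diff_distrib mult_ac)
  have "A * ((p - y) \<bullet> p)
      \<le> A * (2 * (\<Sum>i\<in>UNIV. coef i p) - 4 * a * (\<Sum>i\<in>UNIV. coef i p * ((p - y) \<bullet> q i)\<^sup>2))"
    using q(2) unfolding lhs rhs .
  then have main: "(p - y) \<bullet> p
      \<le> 2 * (\<Sum>i\<in>UNIV. coef i p) - 4 * a * (\<Sum>i\<in>UNIV. coef i p * ((p - y) \<bullet> q i)\<^sup>2)"
    using A by simp
  have "c * ((p - y) \<bullet> (p - y)) = (\<Sum>i\<in>UNIV. c * ((p - y) \<bullet> q i)\<^sup>2)"
    by (simp add: orthonormal_parseval[OF q(1)] flip: sum_distrib_left)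
  also have "\<dots> \<le> (\<Sum>i\<in>UNIV. coef i p * ((p - y) \<bullet> q i)\<^sup>2)"
    using c p(1) by (intro sum_mono mult_right_mono) auto
  finally have 1: "c * ((p - y) \<bullet> (p - y)) \<le> (\<Sum>i\<in>UNIV. coef i p * ((p - y) \<bullet> q i)\<^sup>2)" .
  have "r / 2 \<le> norm (p - y)" using pz dist_triangle[of z y p] by (simp add: r_def dist_norm)
  then have "(r / 2)\<^sup>2 \<le> (norm (p - y))\<^sup>2" using r by (intro power_mono) auto
  then have "c * (r\<^sup>2 / 4) \<le> c * ((p - y) \<bullet> (p - y))"
    using c by (simp add: power2_norm_eq_inner power_divide)
  with 1 have "4 * a * (c * (r\<^sup>2 / 4)) \<le> 4 * a * (\<Sum>i\<in>UNIV. coef i p * ((p - y) \<bullet> q i)\<^sup>2)"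
    using a by (intro mult_left_mono) auto
  moreover have "2 * (\<Sum>i\<in>UNIV. coef i p) \<le> 2 * (CARD('n) * (phi p)\<^sup>2)" using sum_coef_le by simp
  ultimately have "a * (c * r\<^sup>2) \<le> b" using main b[OF p(1)] by simp
  with a show False by simp
qed

text \<open>From a point \<open>y0\<close> where the maximum is missed, a nearest maximum point
  \<open>z\<close> provides a ball touching the set of maxima at its boundary, which
  \<open>no_touching_ball\<close> excludes.\<close>

lemma phi_constant: "phi x = phi y"
proof -
  obtain p0 where max: "\<And>x. phi x \<le> phi p0" using phi_attains_max by blast
  let ?M = "phi p0"
  have "phi y0 = ?M" for y0
  proof (rule ccontr)
    assume ne: "phi y0 \<noteq> ?M"
    let ?K = "{x. phi x = ?M}"
    have "closed ?K" by (intro closed_Collect_eq continuous_on_phi continuous_on_const)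
    moreover have "p0 \<in> ?K" by simp
    ultimately obtain z where z: "z \<in> ?K" "\<And>x. x \<in> ?K \<Longrightarrow> dist y0 z \<le> dist y0 x"
      using distance_attains_inf[of ?K y0] by blast
    \<comment> \<open>Halving the ball about \<open>y0\<close> makes it touch the larger sphere only
      at \<open>z\<close>, so its closure contains no other maximum point.\<close>
    define y where "y = (1 / 2) *\<^sub>R (y0 + z)"
    have zy: "z - y = y - y0" by (simp add: y_def algebra_simps flip: scaleR_add_left)
    show False
    proof (rule no_touching_ball[OF max])
      show "phi z = ?M" using z by simp
      show "z \<noteq> y" using zy z ne by auto
      fix x assume x: "dist x y \<le> dist z y" "x \<noteq> z"
      show "phi x < ?M"
      proof (rule ccontr)
        assume "\<not> phi x < ?M"
        then have "x \<in> ?K" using max[of x] by simp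
        then have "dist y0 z \<le> dist y0 x" by (rule z)
        define s where "s = x - y" define t where "t = z - y"
        \<comment> \<open>As \<open>y\<close> is the midpoint, \<open>t + t\<close> is
          \<open>z - y0\<close> and \<open>s + t\<close> is \<open>x - y0\<close>. Together with
          \<open>norm s \<le> norm t\<close>, the parallelogram law forces
          \<open>s = t\<close>.\<close>
        have "norm (t + t) \<le> norm (s + t)"
          using \<open>dist y0 z \<le> dist y0 x\<close> zy unfolding s_def t_def
          by (simp add: dist_norm norm_minus_commute)
        then have "(norm (t + t))\<^sup>2 \<le> (norm (s + t))\<^sup>2" by (intro power_mono) auto
        moreover have "(norm s)\<^sup>2 \<le> (norm t)\<^sup>2"
          using x(1) by (intro power_mono) (auto simp: s_def t_def dist_norm)
        ultimately have "(s - t) \<bullet> (s - t) \<le> 0"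
          unfolding power2_norm_eq_inner inner_add_left inner_add_right inner_diff_left inner_diff_right
            inner_commute[of t s] by linarith
        then have "s = t" by (simp add: inner_gt_zero_iff[symmetric] not_less[symmetric])
        then show False using x(2) by (simp add: s_def t_def)
      qed
    qed
  qed
  then show ?thesis by metis
qed

text \<open>Differentiating the constant \<open>phi\<close> gives Euler identities of weight 1/2 for
  the first and 0 for the second derivatives. Once the latter are constant, the weight 1/2 identity
  recovers the gradient and the weight 1 identity recovers \<open>u\<close>, with no linear
  term.\<close>

lemma quadratic_polynomial_u: "quadratic_polynomial u"
proof -
  define c where "c = phi 0"
  have "phi = (\<lambda>x. c)" using phi_constant by (auto simp: c_def)
  have p0: "partial_deriv i (\<lambda>x :: real^'n. d) x = 0" for i d x
    by (rule partial_deriv_eqI) (rule has_derivative_const)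
  have first: "euler (1 / 2) (partial_deriv i u) = (\<lambda>x. 0)" for i
    using partial_deriv_euler[OF smooth, of i 1] by (simp add: \<open>phi = _\<close> p0 fun_eq_iff)
  have second: "euler 0 (partial_deriv j (partial_deriv i u)) = (\<lambda>x. 0)" for i j
    using partial_deriv_euler[OF smooth_fun_partial[OF smooth], of j "1 / 2" i]
    by (simp add: first p0 fun_eq_iff)
  have const: "partial_deriv j (partial_deriv i u) x = partial_deriv j (partial_deriv i u) 0" for i j x
  proof -
    let ?w = "partial_deriv j (partial_deriv i u)"
    have "((\<lambda>t. ?w (0 + t *\<^sub>R x)) has_real_derivative
        (\<Sum>r\<in>UNIV. x $ r * partial_deriv r ?w (0 + t *\<^sub>R x))) (at t)" for t
      by (intro line_deriv smooth_fun_differentiable smooth_fun_partial smooth)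
    from MVT2[OF zero_less_one this] obtain t where t: "0 < t"
      "?w (0 + 1 *\<^sub>R x) - ?w (0 + 0 *\<^sub>R x) = (1 - 0) * (\<Sum>r\<in>UNIV. x $ r * partial_deriv r ?w (0 + t *\<^sub>R x))"
      by blast
    \<comment> \<open>At the mean value point \<open>t > 0\<close>, so the factor \<open>t\<close>
      cancels; at \<open>t = 0\<close> the identity would say nothing about the derivative along
      \<open>x\<close>.\<close>
    have "euler 0 ?w (t *\<^sub>R x) = 0" by (simp add: second)
    then have "(\<Sum>r\<in>UNIV. (t *\<^sub>R x) $ r * partial_deriv r ?w (t *\<^sub>R x)) = 0"
      unfolding euler_def by simp
    then have "t * (\<Sum>r\<in>UNIV. x $ r * partial_deriv r ?w (t *\<^sub>R x)) = 0"
      by (simp add: sum_distrib_left mult_ac)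
    then show ?thesis using t by simp
  qed
  define A where "A = hessian u 0"
  have grad: "partial_deriv i u x = (A *v x) $ i" for i x
  proof -
    have "euler (1 / 2) (partial_deriv i u) x = 0" by (simp add: first)
    then have "partial_deriv i u x = (\<Sum>j\<in>UNIV. x $ j * partial_deriv j (partial_deriv i u) x)"
      by (simp add: euler_def)
    then show ?thesis by (simp add: const[of _ _ x] A_def hessian_def matrix_vector_mult_def mult.commute)
  qed
  have "u x = x \<bullet> (((1 / 2) *\<^sub>R A) *v x) + 0 \<bullet> x + (- c)" for x
  proof -
    have "phi x = c" by (simp add: \<open>phi = _\<close>)
    then have "u x = (1 / 2) * (x \<bullet> (A *v x)) - c" by (simp add: euler_def grad inner_vec_def)
    then show ?thesis by (simp flip: scaleR_matrix_vector_assoc)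
  qed
  then show ?thesis unfolding quadratic_polynomial_def by blast
qed

end

theorem corollary1p4:
  fixes u :: "real^'n::finite \<Rightarrow> real" and k :: nat
  assumes "1 \<le> k" and "k \<le> CARD('n)"
    and "smooth_fun u"
    and "k_convex k u"
    and "\<And>x. - (elem_sym (k - 1) (eigenvals (hessian u x)) / elem_sym k (eigenvals (hessian u x)))
               = (1 / 2) * (x \<bullet> gradient u x) - u x"
  shows "quadratic_polynomial u"
proof -
  obtain m where k: "k = Suc m" using assms(1) by (cases k) auto
  interpret shrinker u m
  proof
    show "esym j UNIV (($) (eigenvals (hessian u x))) > 0" if "j \<le> Suc m" for j x
      using assms(4) that unfolding k_convex_def Gamma_cone_def k
      \<comment> \<open>\<open>Gamma_cone\<close> starts at degree 1; degree 0 is the constant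
        1.\<close>
      by (cases j) (auto simp: elem_sym_eq_esym)
    show "- (esym m UNIV (($) (eigenvals (hessian u x))) / esym (Suc m) UNIV (($) (eigenvals (hessian u x))))
        = (1 / 2) * (x \<bullet> gradient u x) - u x" for x
      using assms(5)[of x] by (simp add: k elem_sym_eq_esym)
  qed (use assms k in auto)
  show ?thesis by (rule quadratic_polynomial_u)
qed

end
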